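(* $\mathcal{TC}(\mathrm{UF})=\mathrm{CS}$.
   Context: A language is union-free if it can be described by a regular expression built only using concatenation (product) and Kleene star (from the atomic expressions $\emptyset$ and single letters); $\mathrm{UF}$ is the family of union-free languages. A tree-controlled grammar is a quintuple $G=(N,T,P,S,R)$ where $(N,T,P,S)$ is a context-free grammar whose rules are all non-erasing, except that $S\to\lambda$ is allowed if $S$ does not occur on the right-hand side of any rule, and $R\subseteq (N\cup T)^*$ is a regular control language. The word of level $j$ of a derivation tree is the word of all nodes of depth $j$ read left to right. $L(G)$ consists of all $z\in T^*$ having a derivation tree with yield $z$ such that the words of all levels except the last belong to $R$. For a family $\mathcal F$ of regular languages, $\mathcal{TC}(\mathcal F)$ is the family of languages generated by tree-controlled grammars with control language in $\mathcal F$. $\mathrm{CS}$ is the family of context-sensitive languages. *)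

theory Defs
  imports Main
begin

datatype ('n, 't) sym = NT 'n | Tm 't

datatype 'a ufexp = UEmpty | USym 'a | UConc "'a ufexp" "'a ufexp" | UStar "'a ufexp"

definition conc_lang :: "'a list set \<Rightarrow> 'a list set \<Rightarrow> 'a list set" where
  "conc_lang A B = {u @ v | u v. u \<in> A \<and> v \<in> B}"

definition star_lang :: "'a list set \<Rightarrow> 'a list set" where
  "star_lang A = {concat ws | ws. set ws \<subseteq> A}"

fun uf_lang :: "'a ufexp \<Rightarrow> 'a list set" where
  "uf_lang UEmpty = {}"
| "uf_lang (USym a) = {[a]}"
| "uf_lang (UConc e f) = conc_lang (uf_lang e) (uf_lang f)"
| "uf_lang (UStar e) = star_lang (uf_lang e)"

definition union_free :: "'a list set \<Rightarrow> bool" where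
  "union_free L \<longleftrightarrow> (\<exists>e. uf_lang e = L)"

definition csg :: "nat set \<Rightarrow> 't set \<Rightarrow> ((nat,'t) sym list \<times> (nat,'t) sym list) set \<Rightarrow> nat \<Rightarrow> bool" where
  "csg N T P S \<longleftrightarrow> finite N \<and> finite T \<and> finite P \<and> S \<in> N \<and>
     (\<forall>(l, r) \<in> P. set l \<subseteq> NT ` N \<union> Tm ` T \<and> set r \<subseteq> NT ` N \<union> Tm ` T \<and>
        ((\<exists>u A v w. A \<in> N \<and> w \<noteq> [] \<and> l = u @ [NT A] @ v \<and> r = u @ w @ v) \<or>
         (l = [NT S] \<and> r = [] \<and> (\<forall>(l', r') \<in> P. NT S \<notin> set r'))))"

definition derive1 :: "('s list \<times> 's list) set \<Rightarrow> 's list \<Rightarrow> 's list \<Rightarrow> bool" where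
  "derive1 P x y \<longleftrightarrow> (\<exists>u v l r. (l, r) \<in> P \<and> x = u @ l @ v \<and> y = u @ r @ v)"

definition cs_lang :: "((nat,'t) sym list \<times> (nat,'t) sym list) set \<Rightarrow> nat \<Rightarrow> 't list set" where
  "cs_lang P S = {z. (derive1 P)\<^sup>*\<^sup>* [NT S] (map Tm z)}"

definition CS :: "'t list set set" where
  "CS = {L. \<exists>N T P S. csg N T P S \<and> L = cs_lang P S}"

text \<open>Derivation trees: a terminal leaf, or an inner node labelled by a
  nonterminal with the list of its children.  An inner node with no children
  represents the application of S \<rightarrow> \<lambda> (the \<lambda>-leaf being at the next level).\<close>

datatype ('n, 't) dtree = Leaf 't | Inner 'n "('n, 't) dtree list"

fun root :: "('n,'t) dtree \<Rightarrow> ('n,'t) sym" where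
  "root (Leaf a) = Tm a"
| "root (Inner A ts) = NT A"

fun yield :: "('n,'t) dtree \<Rightarrow> 't list" where
  "yield (Leaf a) = [a]"
| "yield (Inner A ts) = concat (map yield ts)"

fun height :: "('n,'t) dtree \<Rightarrow> nat" where
  "height (Leaf a) = 0"
| "height (Inner A ts) = Suc (fold max (map height ts) 0)"

fun level :: "nat \<Rightarrow> ('n,'t) dtree \<Rightarrow> ('n,'t) sym list" where
  "level 0 t = [root t]"
| "level (Suc j) (Leaf a) = []"
| "level (Suc j) (Inner A ts) = concat (map (level j) ts)"

fun valid_tree :: "('n \<times> ('n,'t) sym list) set \<Rightarrow> ('n,'t) dtree \<Rightarrow> bool" where
  "valid_tree P (Leaf a) = True"
| "valid_tree P (Inner A ts) = ((A, map root ts) \<in> P \<and> list_all (valid_tree P) ts)"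

definition tcg :: "nat set \<Rightarrow> 't set \<Rightarrow> (nat \<times> (nat,'t) sym list) set \<Rightarrow> nat \<Rightarrow> (nat,'t) sym list set \<Rightarrow> bool" where
  "tcg N T P S R \<longleftrightarrow> finite N \<and> finite T \<and> finite P \<and> S \<in> N \<and>
     (\<forall>(A, w) \<in> P. A \<in> N \<and> set w \<subseteq> NT ` N \<union> Tm ` T \<and>
        (w \<noteq> [] \<or> (A = S \<and> (\<forall>(B, w') \<in> P. NT S \<notin> set w')))) \<and>
     R \<subseteq> lists (NT ` N \<union> Tm ` T)"

definition tc_lang :: "(nat \<times> (nat,'t) sym list) set \<Rightarrow> nat \<Rightarrow> (nat,'t) sym list set \<Rightarrow> 't list set" where
  "tc_lang P S R = {z. \<exists>t. valid_tree P t \<and> root t = NT S \<and> yield t = z \<and>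
                        (\<forall>j < height t. level j t \<in> R)}"

definition TC_UF :: "'t list set set" where
  "TC_UF = {L. \<exists>N T P S R. tcg N T P S R \<and> union_free R \<and> L = tc_lang P S R}"

end

(* Both inclusions go through one observation: the levels of a derivation tree, with the terminal
   leaves kept in place after their level, form a sequence of words in which every letter is
   rewritten at once.

   CS in TC(UF): the tree grammar copies plain symbols from level to level and may mark the letters
   of a left-hand side l by the positions of l in a rule (l, r). The levels must be products of plain
   letters and completely marked left-hand sides; such a language star W with W finite is union-free,
   because star (A \<union> B) = star (star A . star B). Terminals do not occur in W, so
   they appear in the last level only.

   TC(UF) in CS: a regular language has finitely many residuals. A left-to-right sweep over the
   current level rewrites each letter and carries the residual of the part read so far; a return
   sweep, started only if the whole level was accepted, makes the new level ready. Each rule rewrites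
   a single cell in the context of a neighbour, so it is context-sensitive as it stands. *)

theory Submission
  imports Defs
begin

text \<open>A control language judges one level at a time and never compares two levels. The choice
  of a rule must therefore be legible in a single word: each marked letter names both the rule and
  its position, so a product of plain letters and complete blocks contains no half-marked left-hand
  side. A marked letter has a single continuation, hence a complete block can only become its
  right-hand side on the next level. Several blocks on one level are applications to disjoint
  segments and do no harm. The construction rests on the fact that non-erasing context-sensitive
  rules never shorten a word, so that every marked letter receives a nonempty share of the
  right-hand side.

  In the converse, residuals are the states of a deterministic automaton that is read off the
  language itself, without a construction from the expression.

  The empty word is treated apart in both directions. The erasing rule can act only at the very
  start, so it is removed, and one rule of a new start symbol restores its effect.\<close>

section \<open>Levels of derivation trees\<close>

text \<open>\<open>Fin a\<close> is a terminal leaf of an earlier level: it no longer contributes to the level word.\<close>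

datatype ('n, 't) item = Act "('n, 't) sym" | Fin 't

text \<open>A terminal never vanishes, so the yield can be read off the last word of a run although
  the leaves of a tree lie at different depths.\<close>

fun expand :: "('n \<times> ('n, 't) sym list) set \<Rightarrow> ('n, 't) item \<Rightarrow> ('n, 't) item list set" where
  "expand P (Act (NT A)) = {map Act w | w. (A, w) \<in> P}"
| "expand P (Act (Tm a)) = {[Fin a]}"
| "expand P (Fin a) = {[Fin a]}"

fun active :: "('n, 't) item list \<Rightarrow> ('n, 't) sym list" where
  "active [] = []"
| "active (Act s # g) = s # active g"
| "active (Fin a # g) = active g"

text \<open>With \<open>None\<close> on nonterminals, the single equation
  \<open>map trm g = map Some z\<close> says that \<open>g\<close> is free of nonterminals and
  spells \<open>z\<close>.\<close>

fun trm :: "('n, 't) item \<Rightarrow> 't option" where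
  "trm (Act (NT A)) = None"
| "trm (Act (Tm a)) = Some a"
| "trm (Fin a) = Some a"

text \<open>Parallel rewriting as in Lindenmayer systems. The table \<open>ex\<close> is a parameter
  because the relation serves both for items and, later, for items with end flags.\<close>

inductive lstep :: "('c \<Rightarrow> 'c list set) \<Rightarrow> 'c list \<Rightarrow> 'c list \<Rightarrow> bool" for ex where
  lstep_Nil: "lstep ex [] []"
| lstep_Cons: "w \<in> ex X \<Longrightarrow> lstep ex g h \<Longrightarrow> lstep ex (X # g) (w @ h)"

inductive_cases lstep_NilE: "lstep ex [] h"
inductive_cases lstep_ConsE: "lstep ex (X # g) h"

lemma lstep_append: "lstep ex g h \<Longrightarrow> lstep ex g' h' \<Longrightarrow> lstep ex (g @ g') (h @ h')"
  by (induction rule: lstep.induct) (simp_all add: lstep_Cons)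

lemma lstep_appendE:
  assumes "lstep ex (g @ g') h"
  obtains h1 h2 where "h = h1 @ h2" "lstep ex g h1" "lstep ex g' h2"
  using assms
proof (induction g arbitrary: h thesis)
  case Nil
  then show ?case by (metis append_Nil lstep_Nil)
next
  case (Cons X g)
  from Cons.prems(2) obtain w k where "h = w @ k" "w \<in> ex X" "lstep ex (g @ g') k"
    by (auto elim: lstep_ConsE)
  moreover from Cons.IH[OF _ this(3)] obtain k1 k2 where "k = k1 @ k2" "lstep ex g k1" "lstep ex g' k2"
    by blast
  ultimately show ?case using Cons.prems(1)[of "w @ k1" k2] by (simp add: lstep_Cons)
qed

lemma lstep_single: "lstep ex [X] h \<longleftrightarrow> h \<in> ex X"
  by (metis append_Nil2 lstep_Cons lstep_ConsE lstep_Nil lstep_NilE)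

lemma lstep_singletons:
  "(\<And>X. X \<in> set g \<Longrightarrow> [f X] \<in> ex X) \<Longrightarrow> lstep ex g (map f g)"
proof (induction g)
  case (Cons X g)
  then show ?case using lstep_Cons[of "[f X]" ex X g "map f g"] by simp
qed (simp add: lstep_Nil)

lemma active_append [simp]: "active (g @ h) = active g @ active h"
  by (induction g rule: active.induct) auto

lemma active_map_Act [simp]: "active (map Act w) = w"
  by (induction w) auto

text \<open>\<open>tc_lang\<close> fixes the nonterminals to \<open>nat\<close>, while the
  constructions below use structured ones; renaming to \<open>nat\<close> comes at the end.\<close>

definition tree_lang :: "('n \<times> ('n, 't) sym list) set \<Rightarrow> 'n \<Rightarrow> ('n, 't) sym list set \<Rightarrow> 't list set" where
  "tree_lang P S R = {z. \<exists>t. valid_tree P t \<and> root t = NT S \<and> yield t = z \<and>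
                        (\<forall>j < height t. level j t \<in> R)}"

lemma tc_lang_eq_tree_lang: "tc_lang = tree_lang"
  by (simp add: fun_eq_iff tc_lang_def tree_lang_def)

text \<open>The control condition concerns the source of a step only: the end of a run is
  unconstrained, as is the last level of a tree.\<close>

definition gstep :: "('n \<times> ('n, 't) sym list) set \<Rightarrow> ('n, 't) sym list set \<Rightarrow>
    ('n, 't) item list \<Rightarrow> ('n, 't) item list \<Rightarrow> bool" where
  "gstep P R g h \<longleftrightarrow> active g \<in> R \<and> lstep (expand P) g h"

lemma fold_max_le: "fold max xs m \<le> n \<longleftrightarrow> m \<le> n \<and> (\<forall>x\<in>set xs. x \<le> (n::nat))"
  by (induction xs arbitrary: m) auto

lemma height_Inner_le: "height (Inner A ts) \<le> Suc n \<longleftrightarrow> (\<forall>t\<in>set ts. height t \<le> n)"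
  by (simp add: fold_max_le)

section \<open>Trees and runs of level words\<close>

fun items :: "nat \<Rightarrow> ('n, 't) dtree \<Rightarrow> ('n, 't) item list" where
  "items 0 t = [Act (root t)]"
| "items (Suc j) (Leaf a) = [Fin a]"
| "items (Suc j) (Inner A ts) = concat (map (items j) ts)"

lemma active_concat: "active (concat gs) = concat (map active gs)"
  by (induction gs) auto

lemma active_items: "active (items j t) = level j t"
  by (induction j t rule: items.induct) (auto simp: active_concat comp_def intro!: arg_cong[where f = concat])

lemma trm_items: "height t \<le> n \<Longrightarrow> map trm (items n t) = map Some (yield t)"
proof (induction n t rule: items.induct)
  case (1 t)
  then show ?case by (cases t) auto
next
  case (3 j A ts)
  then have "\<forall>t\<in>set ts. height t \<le> j" by (simp only: height_Inner_le)
  with 3 have "map (map trm \<circ> items j) ts = map (map Some \<circ> yield) ts"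
    by auto
  then show ?case by (simp only: items.simps yield.simps map_concat map_map)
qed auto

lemma lstep_concat:
  "(\<And>x. x \<in> set xs \<Longrightarrow> lstep ex (f x) (g x)) \<Longrightarrow> lstep ex (concat (map f xs)) (concat (map g xs))"
  by (induction xs) (auto intro: lstep_append lstep_Nil)

lemma lstep_items: "valid_tree P t \<Longrightarrow> lstep (expand P) (items j t) (items (Suc j) t)"
proof (induction j t rule: items.induct)
  case (1 t)
  have [simp]: "concat (map (items 0) ts) = map Act (map root ts)" for ts :: "('a, 'b) dtree list"
    by (induction ts) auto
  from 1 show ?case by (cases t) (auto simp: lstep_single simp del: map_map)
next
  case (3 j A ts)
  then show ?case by (auto simp: list_all_iff intro!: lstep_concat)
qed (auto simp: lstep_single)

text \<open>A forest has one entry per item. \<open>Inl (Leaf a)\<close> and \<open>Inr a\<close>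
  stand for the same tree, but the first still counts on the current level and the second ended on
  an earlier one; \<open>flevel\<close> tells them apart.\<close>

fun ftree :: "('n, 't) dtree + 't \<Rightarrow> ('n, 't) dtree" where
  "ftree (Inl t) = t"
| "ftree (Inr a) = Leaf a"

fun fitem :: "('n, 't) dtree + 't \<Rightarrow> ('n, 't) item" where
  "fitem (Inl t) = Act (root t)"
| "fitem (Inr a) = Fin a"

fun flevel :: "nat \<Rightarrow> ('n, 't) dtree + 't \<Rightarrow> ('n, 't) sym list" where
  "flevel j (Inl t) = level j t"
| "flevel j (Inr a) = []"

definition forest_ok :: "('n \<times> ('n, 't) sym list) set \<Rightarrow> nat \<Rightarrow> (('n, 't) dtree + 't) list \<Rightarrow> bool" where
  "forest_ok P n fs \<longleftrightarrow> (\<forall>x\<in>set fs. valid_tree P (ftree x) \<and> height (ftree x) \<le> n)"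

lemma map_fitem_Act: "map fitem fs = map Act w \<Longrightarrow> \<exists>ts. fs = map Inl ts \<and> map root ts = w"
proof (induction fs arbitrary: w)
  case (Cons x fs)
  then obtain s v where w: "w = s # v" by (cases w) auto
  with Cons obtain ts where "fs = map Inl ts \<and> map root ts = v" by fastforce
  moreover from Cons.prems w obtain t where "x = Inl t" "root t = s" by (cases x) auto
  ultimately show ?case using w by (intro exI[of _ "t # ts"]) auto
qed auto

text \<open>The trees below the children of an item are joined under it, which shifts the level
  numbers by one. A terminal item has no later level, in accordance with its child
  \<open>Fin a\<close>.\<close>

lemma forest_extend_item:
  assumes "w \<in> expand P X" "map fitem fs = w" "forest_ok P n fs"
  shows "\<exists>x. fitem x = X \<and> forest_ok P (Suc n) [x] \<and> yield (ftree x) = concat (map (\<lambda>x. yield (ftree x)) fs)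
     \<and> (\<forall>j. flevel (Suc j) x = concat (map (flevel j) fs))"
proof (cases X)
  case (Fin a)
  with assms obtain y where "fs = [y]" "fitem y = Fin a" by auto
  then have "fs = [Inr a]" by (cases y) auto
  then show ?thesis using Fin by (intro exI[of _ "Inr a"]) (auto simp: forest_ok_def)
next
  case (Act s)
  show ?thesis
  proof (cases s)
    case (Tm a)
    with assms Act obtain y where "fs = [y]" "fitem y = Fin a" by auto
    then have "fs = [Inr a]" by (cases y) auto
    then show ?thesis using Act Tm by (intro exI[of _ "Inl (Leaf a)"]) (auto simp: forest_ok_def)
  next
    case (NT A)
    with assms Act obtain v where v: "(A, v) \<in> P" "map fitem fs = map Act v" by auto
    then obtain ts where ts: "fs = map Inl ts" "map root ts = v" using map_fitem_Act by blast
    have ok: "\<forall>t\<in>set ts. valid_tree P t \<and> height t \<le> n"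
      using assms(3) ts by (auto simp: forest_ok_def)
    have "height (Inner A ts) \<le> Suc n" unfolding height_Inner_le using ok by blast
    then have "forest_ok P (Suc n) [Inl (Inner A ts)]"
      using v ts ok by (simp add: forest_ok_def list_all_iff del: height.simps)
    then show ?thesis using Act NT ts
      by (intro exI[of _ "Inl (Inner A ts)"]) (simp add: comp_def del: height.simps)
  qed
qed

lemma forest_extend:
  assumes "lstep (expand P) g h" "map fitem fs = h" "forest_ok P n fs"
  shows "\<exists>xs. map fitem xs = g \<and> forest_ok P (Suc n) xs
     \<and> concat (map (\<lambda>x. yield (ftree x)) xs) = concat (map (\<lambda>x. yield (ftree x)) fs)
     \<and> (\<forall>j. concat (map (flevel (Suc j)) xs) = concat (map (flevel j) fs))"
  using assms
proof (induction arbitrary: fs rule: lstep.induct)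
  case (lstep_Cons w X g h)
  from lstep_Cons.prems(1) obtain f1 f2 where f: "fs = f1 @ f2" "map fitem f1 = w" "map fitem f2 = h"
    by (auto simp: map_eq_append_conv)
  have ok: "forest_ok P n f1" "forest_ok P n f2"
    using lstep_Cons.prems(2) f by (auto simp: forest_ok_def)
  from lstep_Cons.IH[OF f(3) ok(2)] forest_extend_item[OF lstep_Cons.hyps(1) f(2) ok(1)]
  obtain x xs where
    "fitem x = X \<and> forest_ok P (Suc n) [x] \<and> yield (ftree x) = concat (map (\<lambda>x. yield (ftree x)) f1)
     \<and> (\<forall>j. flevel (Suc j) x = concat (map (flevel j) f1))"
    "map fitem xs = g \<and> forest_ok P (Suc n) xs
     \<and> concat (map (\<lambda>x. yield (ftree x)) xs) = concat (map (\<lambda>x. yield (ftree x)) f2)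
     \<and> (\<forall>j. concat (map (flevel (Suc j)) xs) = concat (map (flevel j) f2))"
    by blast
  then show ?case using f by (intro exI[of _ "x # xs"]) (auto simp: forest_ok_def)
qed (auto simp: forest_ok_def)

lemma flevel_0: "concat (map (flevel 0) fs) = active (map fitem fs)"
proof (induction fs)
  case (Cons x fs)
  then show ?case by (cases x) auto
qed simp

text \<open>The forest is grown backwards from the last word, whose items are all leaves. The
  witness \<open>n\<close> is the length of the run; it merely bounds the heights, since a run may
  continue after the last leaf has been reached.\<close>

lemma tree_of_gsteps:
  assumes "(gstep P R)\<^sup>*\<^sup>* g h" "map trm h = map Some z"
  shows "\<exists>n fs. map fitem fs = g \<and> forest_ok P n fs \<and> concat (map (\<lambda>x. yield (ftree x)) fs) = z
     \<and> (\<forall>j<n. concat (map (flevel j) fs) \<in> R)"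
  using assms(1)
proof (induction rule: converse_rtranclp_induct)
  case base
  have "\<exists>fs. map fitem fs = h \<and> forest_ok P 0 fs \<and> concat (map (\<lambda>x. yield (ftree x)) fs) = z"
    using assms(2)
  proof (induction h arbitrary: z)
    case (Cons X h)
    then obtain a v where z: "z = a # v" and a: "trm X = Some a" and v: "map trm h = map Some v"
      by (cases z) auto
    from Cons.IH[OF v] obtain fs where
      fs: "map fitem fs = h \<and> forest_ok P 0 fs \<and> concat (map (\<lambda>x. yield (ftree x)) fs) = v" by blast
    from a have "X = Act (Tm a) \<or> X = Fin a" by (cases X rule: trm.cases) auto
    then show ?case
    proof
      assume "X = Act (Tm a)"
      then show ?thesis using fs z by (intro exI[of _ "Inl (Leaf a) # fs"]) (auto simp: forest_ok_def)
    next
      assume "X = Fin a"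
      then show ?thesis using fs z by (intro exI[of _ "Inr a # fs"]) (auto simp: forest_ok_def)
    qed
  qed (auto simp: forest_ok_def)
  then show ?case by blast
next
  case (step g h')
  then obtain n fs where fs: "map fitem fs = h'" "forest_ok P n fs" "concat (map (\<lambda>x. yield (ftree x)) fs) = z"
     "\<forall>j<n. concat (map (flevel j) fs) \<in> R" by blast
  from step.hyps(1) have st: "active g \<in> R" "lstep (expand P) g h'" by (auto simp: gstep_def)
  from forest_extend[OF st(2) fs(1,2)] obtain xs where
    xs: "map fitem xs = g" "forest_ok P (Suc n) xs"
     "concat (map (\<lambda>x. yield (ftree x)) xs) = concat (map (\<lambda>x. yield (ftree x)) fs)"
     "\<forall>j. concat (map (flevel (Suc j)) xs) = concat (map (flevel j) fs)" by blast
  have "concat (map (flevel j) xs) \<in> R" if "j < Suc n" for j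
  proof (cases j)
    case 0
    then show ?thesis using st(1) xs(1) flevel_0[of xs] by simp
  next
    case (Suc i)
    then show ?thesis using that fs(4) xs(4) by simp
  qed
  moreover have "concat (map (\<lambda>x. yield (ftree x)) xs) = z" using xs(3) fs(3) by simp
  ultimately show ?case using xs(1,2) by (intro exI[of _ "Suc n"] exI[of _ xs]) simp
qed

text \<open>A tree gives a run of exactly \<open>height t\<close> steps. In the other direction a
  longer run does no harm: it puts at least the levels below \<open>height t\<close> into
  \<open>R\<close>.\<close>

lemma tree_lang_iff:
  "z \<in> tree_lang P S R \<longleftrightarrow> (\<exists>g. (gstep P R)\<^sup>*\<^sup>* [Act (NT S)] g \<and> map trm g = map Some z)"
proof
  assume "z \<in> tree_lang P S R"
  then obtain t where t: "valid_tree P t" "root t = NT S" "yield t = z" "\<forall>j<height t. level j t \<in> R"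
    by (auto simp: tree_lang_def)
  have "(gstep P R)\<^sup>*\<^sup>* [Act (NT S)] (items j t)" if "j \<le> height t" for j
    using that
  proof (induction j)
    case (Suc j)
    then have "gstep P R (items j t) (items (Suc j) t)"
      using t lstep_items by (auto simp: gstep_def active_items)
    with Suc show ?case by (simp add: rtranclp.rtrancl_into_rtrancl)
  qed (simp add: t)
  then show "\<exists>g. (gstep P R)\<^sup>*\<^sup>* [Act (NT S)] g \<and> map trm g = map Some z"
    using trm_items[of t "height t"] t(3) by blast
next
  assume "\<exists>g. (gstep P R)\<^sup>*\<^sup>* [Act (NT S)] g \<and> map trm g = map Some z"
  then obtain g where "(gstep P R)\<^sup>*\<^sup>* [Act (NT S)] g" "map trm g = map Some z" by blast
  from tree_of_gsteps[OF this] obtain n fs where fs: "map fitem fs = [Act (NT S)]" "forest_ok P n fs"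
     "concat (map (\<lambda>x. yield (ftree x)) fs) = z" "\<forall>j<n. concat (map (flevel j) fs) \<in> R"
    by (elim exE conjE) (rule that)
  from fs(1) obtain t where "fs = [Inl t]" "root t = NT S"
    using map_fitem_Act[of fs "[NT S]"] by auto
  then show "z \<in> tree_lang P S R" using fs by (auto simp: tree_lang_def forest_ok_def)
qed

section \<open>Renaming nonterminals to natural numbers\<close>

abbreviation rename :: "('n \<Rightarrow> 'm) \<Rightarrow> ('n, 't) sym \<Rightarrow> ('m, 't) sym" where
  "rename h \<equiv> map_sym h (\<lambda>a. a)"

lemma rename_inverse:
  assumes "inj_on h N" "s \<in> NT ` N \<union> Tm ` T"
  shows "rename (inv_into N h) (rename h s) = s"
  using assms by auto

lemma map_rename_inverse:
  assumes "inj_on h N" "set w \<subseteq> NT ` N \<union> Tm ` T"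
  shows "map (rename (inv_into N h)) (map (rename h) w) = w"
  using assms(2) rename_inverse[OF assms(1)] by (induction w) auto

lemma finite_symbols_cover:
  assumes "finite (X :: ('n, 't) sym set)"
  obtains N T where "finite N" "finite T" "X \<subseteq> NT ` N \<union> Tm ` T" "NT ` N \<subseteq> X" "Tm ` T \<subseteq> X"
proof
  show "finite {A. NT A \<in> X}" "finite {a. Tm a \<in> X}"
    using assms finite_vimageI[of X NT] finite_vimageI[of X Tm] by (auto simp: vimage_def inj_def)
  show "X \<subseteq> NT ` {A. NT A \<in> X} \<union> Tm ` {a. Tm a \<in> X}"
  proof
    fix x assume "x \<in> X"
    then show "x \<in> NT ` {A. NT A \<in> X} \<union> Tm ` {a. Tm a \<in> X}" by (cases x) auto
  qed
qed auto

lemma uf_lang_map: "uf_lang (map_ufexp f e) = map f ` uf_lang e"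
proof (induction e)
  case (UConc e1 e2)
  have "conc_lang (map f ` A) (map f ` B) = map f ` conc_lang A B" for A B
    by (auto simp: conc_lang_def image_iff) (metis map_append)+
  with UConc show ?case by simp
next
  case (UStar e)
  have "star_lang (map f ` A) = map f ` star_lang A" for A
  proof
    show "map f ` star_lang A \<subseteq> star_lang (map f ` A)"
      by (force simp: star_lang_def map_concat)
    show "star_lang (map f ` A) \<subseteq> map f ` star_lang A"
    proof
      fix x assume "x \<in> star_lang (map f ` A)"
      then obtain ws where ws: "x = concat ws" "set ws \<subseteq> map f ` A" by (auto simp: star_lang_def)
      then have "ws \<in> map (map f) ` lists A" by (simp add: in_lists_conv_set subset_iff flip: lists_image)
      then obtain vs where "ws = map (map f) vs" "set vs \<subseteq> A" by (auto simp: in_lists_conv_set)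
      then have "x = map f (concat vs)" "concat vs \<in> star_lang A"
        using ws(1) by (auto simp: star_lang_def map_concat)
      then show "x \<in> map f ` star_lang A" by blast
    qed
  qed
  with UStar show ?case by simp
qed auto

lemma uf_lang_atoms: "uf_lang e \<subseteq> lists (set_ufexp e)"
  by (induction e) (fastforce simp: conc_lang_def star_lang_def)+

section \<open>Renaming in tree-controlled grammars\<close>

definition rename_cf :: "('n \<Rightarrow> 'm) \<Rightarrow> ('n \<times> ('n, 't) sym list) set \<Rightarrow> ('m \<times> ('m, 't) sym list) set" where
  "rename_cf h P = (\<lambda>(A, w). (h A, map (rename h) w)) ` P"

lemma root_map: "root (map_dtree h (\<lambda>a. a) t) = rename h (root t)"
  by (cases t) auto

lemma yield_map: "yield (map_dtree h (\<lambda>a. a) t) = yield t"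
proof (induction t)
  case (Inner A ts)
  then show ?case by (auto intro!: arg_cong[where f = concat])
qed auto

lemma height_map: "height (map_dtree h (\<lambda>a. a) t) = height t"
proof (induction t)
  case (Inner A ts)
  then have "map height (map (map_dtree h (\<lambda>a. a)) ts) = map height ts" by simp
  then show ?case by (simp only: dtree.map height.simps)
qed auto

lemma level_map: "level j (map_dtree h (\<lambda>a. a) t) = map (rename h) (level j t)"
proof (induction j t rule: level.induct)
  case (1 t)
  then show ?case by (simp add: root_map)
next
  case (3 j A ts)
  then show ?case by (auto simp: map_concat intro!: arg_cong[where f = concat])
qed auto

lemma valid_tree_map: "valid_tree P t \<Longrightarrow> valid_tree (rename_cf h P) (map_dtree h (\<lambda>a. a) t)"
proof (induction t)
  case (Inner A ts)
  have "(h A, map (rename h) (map root ts)) \<in> rename_cf h P"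
    using Inner.prems by (force simp: rename_cf_def)
  with Inner show ?case by (simp add: list_all_iff root_map comp_def)
qed auto

text \<open>An arbitrary \<open>h\<close> can only enlarge the language. Equality is obtained by
  renaming back with \<open>inv_into\<close>, which inverts an injective \<open>h\<close> on the
  finitely many nonterminals in use.\<close>

lemma tree_lang_rename: "tree_lang P S R \<subseteq> tree_lang (rename_cf h P) (h S) (map (rename h) ` R)"
proof
  fix z assume "z \<in> tree_lang P S R"
  then obtain t where "valid_tree P t" "root t = NT S" "yield t = z" "\<forall>j<height t. level j t \<in> R"
    by (auto simp: tree_lang_def)
  then show "z \<in> tree_lang (rename_cf h P) (h S) (map (rename h) ` R)"
    unfolding tree_lang_def
    by (intro CollectI exI[of _ "map_dtree h (\<lambda>a. a) t"])
      (auto simp: root_map yield_map height_map level_map valid_tree_map)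
qed


lemma image_map_rename_inverse:
  assumes "inj_on h N" "R \<subseteq> lists (NT ` N \<union> Tm ` T)"
  shows "map (rename (inv_into N h)) ` map (rename h) ` R = R"
proof -
  have "map (rename (inv_into N h)) (map (rename h) w) = w" if "w \<in> R" for w
    using assms that by (intro map_rename_inverse[where T = T]) (auto simp: in_lists_conv_set)
  then show ?thesis by (auto simp: image_image image_iff simp del: map_map)
qed

lemma set_map_rename:
  "set w \<subseteq> NT ` N \<union> Tm ` T \<Longrightarrow> set (map (rename h) w) \<subseteq> NT ` (h ` N) \<union> Tm ` T"
  by fastforce

lemma NT_in_map_rename:
  assumes "inj_on h N" "S \<in> N" "set w \<subseteq> NT ` N \<union> Tm ` T" "NT (h S) \<in> set (map (rename h) w)"
  shows "NT S \<in> set w"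
proof -
  from assms(4) obtain s where s: "s \<in> set w" "rename h s = NT (h S)" by auto
  then obtain A where "s = NT A" "A \<in> N" "h A = h S" using assms(3) by (cases s) auto
  with assms s show ?thesis by (metis inj_onD)
qed

text \<open>The two alphabets are collected from the rules and from the atoms of the expression;
  this is why the control language enters as an expression \<open>e\<close>.\<close>

lemma TC_UF_I:
  fixes P :: "('n \<times> ('n, 't) sym list) set"
  assumes fin: "finite P"
    and start: "\<And>A w. (A, w) \<in> P \<Longrightarrow> w \<noteq> [] \<or> (A = S \<and> (\<forall>(B, v) \<in> P. NT S \<notin> set v))"
  shows "tree_lang P S (uf_lang e) \<in> TC_UF"
proof -
  define X where "X = insert (NT S) (NT ` fst ` P \<union> (\<Union>r\<in>P. set (snd r)) \<union> set_ufexp e)"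
  have "finite (set_ufexp e)" by (induction e) auto
  then have "finite X" using fin by (simp add: X_def)
  then obtain N T where NT: "finite N" "finite T" "X \<subseteq> NT ` N \<union> Tm ` T"
    using finite_symbols_cover by metis
  obtain h :: "'n \<Rightarrow> nat" where inj: "inj_on h N"
    using finite_imp_inj_to_nat_seg[OF NT(1)] by auto
  have S: "S \<in> N" using NT(3) by (auto simp: X_def)
  have P: "A \<in> N" "set w \<subseteq> NT ` N \<union> Tm ` T" if "(A, w) \<in> P" for A w
    using that NT(3) by (force simp: X_def)+
  have R: "uf_lang e \<subseteq> lists (NT ` N \<union> Tm ` T)"
    using uf_lang_atoms[of e] lists_mono[of "set_ufexp e" "NT ` N \<union> Tm ` T"] NT(3) by (auto simp: X_def)
  let ?P = "rename_cf h P" and ?R = "map (rename h) ` uf_lang e"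
  have "map (rename (inv_into N h)) (map (rename h) w) = w \<and> inv_into N h (h A) = A"
    if "(A, w) \<in> P" for A w
    using P[OF that] inj map_rename_inverse[OF inj] by (auto simp del: map_map)
  then have P': "rename_cf (inv_into N h) ?P = P"
    by (force simp: rename_cf_def image_image case_prod_beta image_iff simp del: map_map)
  have R': "map (rename (inv_into N h)) ` ?R = uf_lang e"
    using image_map_rename_inverse[OF inj R] .
  have S': "inv_into N h (h S) = S" using inj S by simp
  have "tree_lang ?P (h S) ?R \<subseteq> tree_lang P S (uf_lang e)"
    using tree_lang_rename[of ?P "h S" ?R "inv_into N h"] unfolding P' R' S' .
  then have "tree_lang P S (uf_lang e) = tree_lang ?P (h S) ?R"
    by (intro equalityI tree_lang_rename)
  moreover have "tcg (h ` N) T ?P (h S) ?R"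
    unfolding tcg_def
  proof (intro conjI)
    show "\<forall>(A, w)\<in>?P. A \<in> h ` N \<and> set w \<subseteq> NT ` h ` N \<union> Tm ` T \<and>
        (w \<noteq> [] \<or> A = h S \<and> (\<forall>(B, w')\<in>?P. NT (h S) \<notin> set w'))"
    proof (clarify)
      fix A w assume "(A, w) \<in> ?P"
      then obtain B v where Bv: "(B, v) \<in> P" "A = h B" "w = map (rename h) v"
        by (auto simp: rename_cf_def)
      have "w \<noteq> [] \<or> A = h S \<and> (\<forall>(B, w')\<in>?P. NT (h S) \<notin> set w')"
      proof (cases "v = []")
        case True
        then have *: "B = S" "\<And>C u. (C, u) \<in> P \<Longrightarrow> NT S \<notin> set u" using start[OF Bv(1)] by auto
        have "NT (h S) \<notin> set u'" if "(C', u') \<in> ?P" for C' u'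
        proof -
          from that obtain C u where "(C, u) \<in> P" "u' = map (rename h) u" by (auto simp: rename_cf_def)
          then show ?thesis using NT_in_map_rename[OF inj S P(2)] *(2) by metis
        qed
        then show ?thesis using * Bv by blast
      qed (use Bv in simp)
      then show "A \<in> h ` N \<and> set w \<subseteq> NT ` h ` N \<union> Tm ` T \<and>
        (w \<noteq> [] \<or> A = h S \<and> (\<forall>(B, w')\<in>?P. NT (h S) \<notin> set w'))"
        using Bv P[OF Bv(1)] set_map_rename by blast
    qed
    show "?R \<subseteq> lists (NT ` h ` N \<union> Tm ` T)"
    proof
      fix w assume "w \<in> ?R"
      then obtain v where "v \<in> uf_lang e" "w = map (rename h) v" by auto
      with R set_map_rename[of v N T h] show "w \<in> lists (NT ` h ` N \<union> Tm ` T)"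
        by (auto simp: in_lists_conv_set subset_iff)
    qed
  qed (use NT S fin in \<open>auto simp: rename_cf_def\<close>)
  moreover have "union_free ?R"
    unfolding union_free_def using uf_lang_map[of "rename h" e] by blast
  ultimately show ?thesis unfolding TC_UF_def tc_lang_eq_tree_lang by blast
qed

section \<open>Renaming in context-sensitive grammars\<close>

definition rename_rules :: "('n \<Rightarrow> 'm) \<Rightarrow> (('n, 't) sym list \<times> ('n, 't) sym list) set \<Rightarrow>
    (('m, 't) sym list \<times> ('m, 't) sym list) set" where
  "rename_rules h P = (\<lambda>(l, r). (map (rename h) l, map (rename h) r)) ` P"

definition phrase_lang :: "(('n, 't) sym list \<times> ('n, 't) sym list) set \<Rightarrow> 'n \<Rightarrow> 't list set" where
  "phrase_lang P S = {z. (derive1 P)\<^sup>*\<^sup>* [NT S] (map Tm z)}"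

lemma derive1_rename: "derive1 P x y \<Longrightarrow> derive1 (rename_rules h P) (map (rename h) x) (map (rename h) y)"
  by (force simp: derive1_def rename_rules_def)

lemma phrase_lang_rename: "phrase_lang P S \<subseteq> phrase_lang (rename_rules h P) (h S)"
proof
  fix z assume "z \<in> phrase_lang P S"
  then have "(derive1 P)\<^sup>*\<^sup>* [NT S] (map Tm z)" by (simp add: phrase_lang_def)
  then have "(derive1 (rename_rules h P))\<^sup>*\<^sup>* (map (rename h) [NT S]) (map (rename h) (map Tm z))"
    by (induction rule: rtranclp_induct) (auto intro: derive1_rename rtranclp.rtrancl_into_rtrancl)
  then show "z \<in> phrase_lang (rename_rules h P) (h S)" by (simp add: phrase_lang_def comp_def)
qed

lemma CS_I:
  fixes P :: "(('n, 't) sym list \<times> ('n, 't) sym list) set"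
  assumes fin: "finite P"
    and rules: "\<And>l r. (l, r) \<in> P \<Longrightarrow> (\<exists>u A v w. w \<noteq> [] \<and> l = u @ [NT A] @ v \<and> r = u @ w @ v) \<or>
      (l = [NT S] \<and> r = [] \<and> (\<forall>(l', r') \<in> P. NT S \<notin> set r'))"
  shows "phrase_lang P S \<in> CS"
proof -
  define X where "X = insert (NT S) (\<Union>r\<in>P. set (fst r) \<union> set (snd r))"
  have "finite X" using fin by (simp add: X_def)
  then obtain N T where NT: "finite N" "finite T" "X \<subseteq> NT ` N \<union> Tm ` T"
    using finite_symbols_cover by metis
  obtain h :: "'n \<Rightarrow> nat" where inj: "inj_on h N"
    using finite_imp_inj_to_nat_seg[OF NT(1)] by auto
  have S: "S \<in> N" using NT(3) by (auto simp: X_def)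
  have P: "set l \<subseteq> NT ` N \<union> Tm ` T" "set r \<subseteq> NT ` N \<union> Tm ` T" if "(l, r) \<in> P" for l r
    using that NT(3) by (force simp: X_def)+
  let ?P = "rename_rules h P"
  have "map (rename (inv_into N h)) (map (rename h) w) = w \<and> map (rename (inv_into N h)) (map (rename h) v) = v"
    if "(w, v) \<in> P" for v w
    using P[OF that] inj map_rename_inverse[OF inj] by (auto simp del: map_map)
  then have P': "rename_rules (inv_into N h) ?P = P"
    by (force simp: rename_rules_def image_image case_prod_beta image_iff simp del: map_map)
  have S': "inv_into N h (h S) = S" using inj S by simp
  have "phrase_lang ?P (h S) \<subseteq> phrase_lang P S"
    using phrase_lang_rename[of ?P "h S" "inv_into N h"] unfolding P' S' .
  then have "phrase_lang P S = phrase_lang ?P (h S)"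
    by (intro equalityI phrase_lang_rename)
  moreover have "csg (h ` N) T ?P (h S)"
    unfolding csg_def
  proof (intro conjI)
    show "\<forall>(l, r)\<in>?P. set l \<subseteq> NT ` h ` N \<union> Tm ` T \<and> set r \<subseteq> NT ` h ` N \<union> Tm ` T \<and>
        ((\<exists>u A v w. A \<in> h ` N \<and> w \<noteq> [] \<and> l = u @ [NT A] @ v \<and> r = u @ w @ v) \<or>
         (l = [NT (h S)] \<and> r = [] \<and> (\<forall>(l', r')\<in>?P. NT (h S) \<notin> set r')))"
    proof (clarify)
      fix l' r' assume "(l', r') \<in> ?P"
      then obtain l r where lr: "(l, r) \<in> P" "l' = map (rename h) l" "r' = map (rename h) r"
        by (auto simp: rename_rules_def)
      have "(\<exists>u A v w. A \<in> h ` N \<and> w \<noteq> [] \<and> l' = u @ [NT A] @ v \<and> r' = u @ w @ v) \<or>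
         (l' = [NT (h S)] \<and> r' = [] \<and> (\<forall>(l', r')\<in>?P. NT (h S) \<notin> set r'))"
        using rules[OF lr(1)]
      proof (elim disjE exE conjE)
        fix u A v w assume a: "w \<noteq> []" "l = u @ [NT A] @ v" "r = u @ w @ v"
        then have "A \<in> N" using P(1)[OF lr(1)] by auto
        then show ?thesis using lr(2,3) a
          by (intro disjI1 exI[of _ "map (rename h) u"] exI[of _ "h A"] exI[of _ "map (rename h) v"]
              exI[of _ "map (rename h) w"]) auto
      next
        assume a: "l = [NT S]" "r = []" "\<forall>(l', r')\<in>P. NT S \<notin> set r'"
        have "NT (h S) \<notin> set u'" if "(v', u') \<in> ?P" for v' u'
        proof -
          from that obtain v u where "(v, u) \<in> P" "u' = map (rename h) u" by (auto simp: rename_rules_def)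
          then show ?thesis using NT_in_map_rename[OF inj S P(2)] a(3) by blast
        qed
        then show ?thesis using a lr by auto
      qed
      moreover have "set l' \<subseteq> NT ` h ` N \<union> Tm ` T" "set r' \<subseteq> NT ` h ` N \<union> Tm ` T"
        unfolding lr by (rule set_map_rename[OF P(1)[OF lr(1)]], rule set_map_rename[OF P(2)[OF lr(1)]])
      ultimately show "set l' \<subseteq> NT ` h ` N \<union> Tm ` T \<and> set r' \<subseteq> NT ` h ` N \<union> Tm ` T \<and>
        ((\<exists>u A v w. A \<in> h ` N \<and> w \<noteq> [] \<and> l' = u @ [NT A] @ v \<and> r' = u @ w @ v) \<or>
         (l' = [NT (h S)] \<and> r' = [] \<and> (\<forall>(l', r')\<in>?P. NT (h S) \<notin> set r')))"
        by (intro conjI)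
    qed
  qed (use NT S fin in \<open>auto simp: rename_rules_def\<close>)
  moreover have "phrase_lang ?P (h S) = cs_lang ?P (h S)" by (simp add: phrase_lang_def cs_lang_def)
  ultimately show ?thesis unfolding CS_def by blast
qed

section \<open>Context-sensitive languages are tree-controlled\<close>

lemma Nil_in_star_lang: "[] \<in> star_lang A"
  by (auto simp: star_lang_def intro: exI[of _ "[]"])

lemma in_star_lang: "w \<in> A \<Longrightarrow> w \<in> star_lang A"
  by (auto simp: star_lang_def intro!: exI[of _ "[w]"])

lemma append_in_star_lang: "u \<in> star_lang A \<Longrightarrow> v \<in> star_lang A \<Longrightarrow> u @ v \<in> star_lang A"
  unfolding star_lang_def by (auto simp flip: concat_append) (metis Un_subset_iff set_append)

lemma concat_in_star_lang: "(\<And>w. w \<in> set ws \<Longrightarrow> w \<in> star_lang A) \<Longrightarrow> concat ws \<in> star_lang A"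
  by (induction ws) (auto simp: Nil_in_star_lang append_in_star_lang)

lemma star_lang_subset: "A \<subseteq> star_lang B \<Longrightarrow> star_lang A \<subseteq> star_lang B"
  using concat_in_star_lang unfolding star_lang_def[of A] by blast

text \<open>There is no atom for the empty word; the star of the empty language supplies it.\<close>

fun word_ufexp :: "'a list \<Rightarrow> 'a ufexp" where
  "word_ufexp [] = UStar UEmpty"
| "word_ufexp (a # w) = UConc (USym a) (word_ufexp w)"

lemma uf_lang_word_ufexp: "uf_lang (word_ufexp w) = {w}"
  by (induction w) (auto simp: conc_lang_def star_lang_def)

text \<open>The induction yields an expression whose language lies between \<open>W\<close> and
  \<open>star_lang W\<close>; one outer star then closes the gap. The empty word is kept in that
  language so that each factor of a product is available on its own, which is how a product imitates
  a union.\<close>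

lemma union_free_star_finite:
  assumes "finite W"
  shows "\<exists>e. uf_lang e = star_lang W"
proof -
  have "\<exists>e. insert [] W \<subseteq> uf_lang e \<and> uf_lang e \<subseteq> star_lang W"
    using assms
  proof (induction W)
    case empty
    then show ?case by (auto simp: star_lang_def intro!: exI[of _ "word_ufexp []"])
  next
    case (insert w W)
    then obtain e where e: "[] \<in> uf_lang e" "W \<subseteq> uf_lang e" "uf_lang e \<subseteq> star_lang W" by auto
    let ?e = "UConc (UStar (word_ufexp w)) e"
    have "uf_lang ?e \<subseteq> star_lang (insert w W)"
    proof
      fix x assume "x \<in> uf_lang ?e"
      then obtain u v where "x = u @ v" "u \<in> star_lang {w}" "v \<in> star_lang W"
        using e(3) by (auto simp: conc_lang_def uf_lang_word_ufexp)
      moreover have "star_lang {w} \<subseteq> star_lang (insert w W)" "star_lang W \<subseteq> star_lang (insert w W)"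
        by (auto intro!: star_lang_subset in_star_lang)
      ultimately show "x \<in> star_lang (insert w W)" by (auto intro: append_in_star_lang)
    qed
    moreover have "insert [] (insert w W) \<subseteq> uf_lang ?e"
    proof
      fix x assume "x \<in> insert [] (insert w W)"
      then consider "x = w" | "x \<in> uf_lang e" using e by auto
      then show "x \<in> uf_lang ?e"
      proof cases
        case 1
        then have "x = w @ []" "w \<in> star_lang {w}" by (auto intro: in_star_lang)
        then show ?thesis using e(1) by (auto simp: conc_lang_def uf_lang_word_ufexp)
      next
        case 2
        then have "x = [] @ x" by simp
        then show ?thesis using 2 Nil_in_star_lang[of "{w}"]
          unfolding uf_lang.simps conc_lang_def uf_lang_word_ufexp by blast
      qed
    qed
    ultimately show ?case by blast
  qed
  then obtain e where "insert [] W \<subseteq> uf_lang e" "uf_lang e \<subseteq> star_lang W" by blast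
  then have "uf_lang (UStar e) = star_lang W"
    by (auto intro!: star_lang_subset intro: in_star_lang)
  then show ?thesis by blast
qed

lemma derive1_context: "derive1 P x y \<Longrightarrow> derive1 P (u @ x @ v) (u @ y @ v)"
  unfolding derive1_def by (metis append_assoc)

lemma derives_context: "(derive1 P)\<^sup>*\<^sup>* x y \<Longrightarrow> (derive1 P)\<^sup>*\<^sup>* (u @ x @ v) (u @ y @ v)"
  by (induction rule: rtranclp_induct) (auto intro: derive1_context rtranclp.rtrancl_into_rtrancl)

lemma derives_append:
  assumes "(derive1 P)\<^sup>*\<^sup>* x y" "(derive1 P)\<^sup>*\<^sup>* x' y'"
  shows "(derive1 P)\<^sup>*\<^sup>* (x @ x') (y @ y')"
  using derives_context[OF assms(1), of "[]" x'] derives_context[OF assms(2), of y "[]"] by simp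

lemma derive1_rule: "(l, r) \<in> P \<Longrightarrow> derive1 P l r"
  unfolding derive1_def by (metis append_Nil append_Nil2)

section \<open>Marked letters: monotone grammars under tree control\<close>

lemma lstep_functional:
  assumes "lstep ex (map f xs) h" "\<And>x w. x \<in> set xs \<Longrightarrow> w \<in> ex (f x) \<Longrightarrow> w = g x"
  shows "h = concat (map g xs)"
  using assms
proof (induction xs arbitrary: h)
  case (Cons x xs)
  from Cons.prems(1) obtain w k where "h = w @ k" "w \<in> ex (f x)" "lstep ex (map f xs) k"
    by (auto elim: lstep_ConsE)
  with Cons show ?case by simp
qed (auto elim: lstep_NilE)

text \<open>\<open>Plain\<close> wraps terminals too: a real terminal drops out of the level word
  after one step and could no longer serve as context. \<open>Start\<close> differs from
  \<open>S\<close> because \<open>S\<close> may occur on right-hand sides, which the start symbol of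
  an erasing rule must not.\<close>

datatype ('n, 't) marked = Start | Plain "('n, 't) sym"
  | Mark "('n, 't) sym list \<times> ('n, 't) sym list" nat

definition block :: "('n, 't) sym list \<times> ('n, 't) sym list \<Rightarrow> (('n, 't) marked, 't) sym list" where
  "block p = map (\<lambda>i. NT (Mark p i)) [0..<length (fst p)]"

text \<open>The last letter of the left-hand side produces the surplus of the right-hand side.\<close>

definition piece :: "('n, 't) sym list \<times> ('n, 't) sym list \<Rightarrow> nat \<Rightarrow> ('n, 't) sym list" where
  "piece p i = (if Suc i = length (fst p) then drop i (snd p) else [snd p ! i])"

text \<open>Reads a level as a sentential form in which the marked rules are still to be applied.
  Marking is invisible under this reading; only the replacement of a block is a derivation
  step.\<close>

fun unmark :: "'n \<Rightarrow> (('n, 't) marked, 't) sym \<Rightarrow> ('n, 't) sym" where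
  "unmark S (Tm a) = Tm a"
| "unmark S (NT Start) = NT S"
| "unmark S (NT (Plain X)) = X"
| "unmark S (NT (Mark p i)) = fst p ! i"

abbreviation plain :: "('n, 't) sym \<Rightarrow> (('n, 't) marked, 't) sym" where
  "plain X \<equiv> NT (Plain X)"

lemma concat_pieces:
  assumes "fst p \<noteq> []" "length (fst p) \<le> length (snd p)"
  shows "concat (map (piece p) [0..<length (fst p)]) = snd p"
proof -
  have *: "concat (map (piece p) [0..<n]) = take n (snd p)" if "n < length (fst p)" for n
    using that
  proof (induction n)
    case (Suc n)
    then show ?case using assms(2) by (simp add: piece_def take_Suc_conv_app_nth)
  qed simp
  obtain n where n: "length (fst p) = Suc n" using assms(1) by (cases "fst p") auto
  with *[of n] show ?thesis by (simp add: piece_def)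
qed

text \<open>The length condition lets the right-hand side be distributed over the marked positions.
  \<open>erase\<close> records whether \<open>Start\<close> may also produce the empty word.\<close>

locale monotone_grammar =
  fixes P :: "(('n, 't) sym list \<times> ('n, 't) sym list) set" and S :: 'n and erase :: bool
  assumes fin: "finite P"
    and mono: "\<And>p. p \<in> P \<Longrightarrow> fst p \<noteq> [] \<and> length (fst p) \<le> length (snd p)"
begin

definition symbols :: "('n, 't) sym set" where
  "symbols = insert (NT S) (\<Union>p\<in>P. set (fst p) \<union> set (snd p))"

definition trules :: "(('n, 't) marked \<times> (('n, 't) marked, 't) sym list) set" where
  "trules = insert (Start, [plain (NT S)]) (if erase then {(Start, [])} else {})
    \<union> (\<lambda>X. (Plain X, [plain X])) ` symbols \<union> (\<lambda>a. (Plain (Tm a), [Tm a])) ` (Tm -` symbols)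
    \<union> (\<Union>p\<in>P. \<Union>i<length (fst p). {(Plain (fst p ! i), [NT (Mark p i)]), (Mark p i, map plain (piece p i))})"

text \<open>The factor \<open>[NT Start]\<close> admits the root level; as \<open>Start\<close> is
  on no right-hand side, it cannot come back.\<close>

definition factors :: "(('n, 't) marked, 't) sym list set" where
  "factors = insert [NT Start] ((\<lambda>X. [plain X]) ` symbols \<union> block ` P)"

definition control :: "(('n, 't) marked, 't) sym list set" where
  "control = star_lang factors"

lemma finite_symbols: "finite symbols"
  using fin by (auto simp: symbols_def)

lemma finite_trules: "finite trules"
  unfolding trules_def using fin finite_symbols finite_vimageI[OF finite_symbols, of Tm] by (auto simp: inj_def)

lemma trules_iff:
  "(Start, w) \<in> trules \<longleftrightarrow> w = [plain (NT S)] \<or> (erase \<and> w = [])"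
  "(Plain X, w) \<in> trules \<longleftrightarrow> (X \<in> symbols \<and> (w = [plain X] \<or> (\<exists>a. X = Tm a \<and> w = [Tm a])))
     \<or> (\<exists>p\<in>P. \<exists>i<length (fst p). X = fst p ! i \<and> w = [NT (Mark p i)])"
  "(Mark p i, w) \<in> trules \<longleftrightarrow> p \<in> P \<and> i < length (fst p) \<and> w = map plain (piece p i)"
  unfolding trules_def by auto

text \<open>Every option of a plain letter unmarks to that letter. Each marked letter has just one
  rule, so a block is forced to become the right-hand side: one derivation step.\<close>

lemma factor_step:
  assumes "w \<in> factors" "w \<noteq> [NT Start]" "lstep (expand trules) (map Act w) g"
  shows "\<exists>b. g = map Act b \<and> NT Start \<notin> set b \<and> (derive1 P)\<^sup>*\<^sup>* (map (unmark S) w) (map (unmark S) b)"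
proof -
  from assms(1,2) consider X where "X \<in> symbols" "w = [plain X]" | p where "p \<in> P" "w = block p"
    by (auto simp: factors_def)
  then show ?thesis
  proof cases
    case 1
    with assms(3) obtain v where v: "(Plain X, v) \<in> trules" "g = map Act v"
      by (auto simp: lstep_single)
    then have "map (unmark S) v = [X] \<and> NT Start \<notin> set v" by (auto simp: trules_iff)
    then show ?thesis using v 1 by auto
  next
    case 2
    have "map Act w = map (\<lambda>i. Act (NT (Mark p i))) [0..<length (fst p)]"
      using 2 by (simp add: block_def)
    then have "g = concat (map (\<lambda>i. map Act (map plain (piece p i))) [0..<length (fst p)])"
      using assms(3) by (intro lstep_functional[where ex = "expand trules" and f = "\<lambda>i. Act (NT (Mark p i))"])
        (auto simp: trules_iff)
    also have "\<dots> = map Act (map plain (concat (map (piece p) [0..<length (fst p)])))"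
      by (simp add: map_concat comp_def)
    also have "\<dots> = map Act (map plain (snd p))"
      using concat_pieces mono 2(1) by metis
    finally have g: "g = map Act (map plain (snd p))" .
    have "map (unmark S) w = fst p"
      using 2 map_nth[of "fst p"] by (simp add: block_def comp_def)
    moreover have "map (unmark S) (map plain (snd p)) = snd p" by (simp add: comp_def)
    ultimately show ?thesis using g 2(1) derive1_rule[of "fst p" "snd p" P]
      by (intro exI[of _ "map plain (snd p)"]) auto
  qed
qed

lemma factors_step:
  assumes "set ws \<subseteq> factors - {[NT Start]}" "lstep (expand trules) (map Act (concat ws)) g"
  shows "\<exists>b. g = map Act b \<and> NT Start \<notin> set b \<and>
    (derive1 P)\<^sup>*\<^sup>* (map (unmark S) (concat ws)) (map (unmark S) b)"
  using assms
proof (induction ws arbitrary: g)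
  case Nil
  then show ?case by (auto elim: lstep_NilE)
next
  case (Cons w ws)
  from Cons.prems(2) obtain g1 g2 where g: "g = g1 @ g2" "lstep (expand trules) (map Act w) g1"
    "lstep (expand trules) (map Act (concat ws)) g2"
    by (auto elim: lstep_appendE)
  from Cons.prems(1) factor_step[OF _ _ g(2)] obtain b1 where
    b1: "g1 = map Act b1" "NT Start \<notin> set b1" "(derive1 P)\<^sup>*\<^sup>* (map (unmark S) w) (map (unmark S) b1)"
    by auto
  from Cons.prems(1) Cons.IH[OF _ g(3)] obtain b2 where
    b2: "g2 = map Act b2" "NT Start \<notin> set b2"
      "(derive1 P)\<^sup>*\<^sup>* (map (unmark S) (concat ws)) (map (unmark S) b2)"
    by auto
  show ?case using g(1) b1 b2 derives_append[OF b1(3) b2(3)]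
    by (intro exI[of _ "b1 @ b2"]) auto
qed

text \<open>All words of a run have the form \<open>map Act b\<close>: no control word contains a
  terminal, so a level with an active terminal has no successor and \<open>Fin\<close> never
  arises.\<close>

lemma gsteps_sound:
  assumes "(gstep trules control)\<^sup>*\<^sup>* [Act (NT Start)] g"
  shows "g = [Act (NT Start)] \<or> (g = [] \<and> erase) \<or>
    (\<exists>b. g = map Act b \<and> NT Start \<notin> set b \<and> (derive1 P)\<^sup>*\<^sup>* [NT S] (map (unmark S) b))"
  using assms
proof (induction rule: rtranclp_induct)
  case (step g h)
  from step.hyps(2) have st: "active g \<in> control" "lstep (expand trules) g h" by (auto simp: gstep_def)
  from step.IH show ?case
  proof (elim disjE exE conjE)
    assume "g = [Act (NT Start)]"
    with st(2) obtain v where "(Start, v) \<in> trules" "h = map Act v" by (auto simp: lstep_single)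
    then have "(h = [] \<and> erase) \<or> h = map Act [plain (NT S)]" by (auto simp: trules_iff)
    then show ?thesis
    proof
      assume "h = map Act [plain (NT S)]"
      then show ?thesis by (intro disjI2 exI[of _ "[plain (NT S)]"]) auto
    qed auto
  next
    assume "g = []" erase
    with st show ?thesis by (auto elim: lstep_NilE)
  next
    fix b assume b: "g = map Act b" "NT Start \<notin> set b" "(derive1 P)\<^sup>*\<^sup>* [NT S] (map (unmark S) b)"
    then obtain ws where ws: "set ws \<subseteq> factors" "b = concat ws"
      using st(1) by (auto simp: control_def star_lang_def)
    \<comment> \<open>A factor \<open>[NT Start]\<close> would put \<open>Start\<close> into
      \<open>b\<close>.\<close>
    then have "set ws \<subseteq> factors - {[NT Start]}" using b(2) by auto
    moreover have "lstep (expand trules) (map Act (concat ws)) h" using st(2) b(1) ws(2) by simp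
    ultimately obtain c where c: "h = map Act c" "NT Start \<notin> set c"
      "(derive1 P)\<^sup>*\<^sup>* (map (unmark S) (concat ws)) (map (unmark S) c)"
      using factors_step by blast
    with b(3) ws(2) have "(derive1 P)\<^sup>*\<^sup>* [NT S] (map (unmark S) c)" by (simp add: rtranclp_trans)
    with c show ?thesis by blast
  qed
qed simp

lemma map_plain_control: "set x \<subseteq> symbols \<Longrightarrow> map plain x \<in> control"
proof (induction x)
  case (Cons X x)
  then have "[plain X] \<in> control" by (auto simp: control_def factors_def intro: in_star_lang)
  with Cons show ?case using append_in_star_lang[of "[plain X]" factors] by (auto simp: control_def)
qed (simp add: control_def Nil_in_star_lang)

lemma block_control: "p \<in> P \<Longrightarrow> block p \<in> control"
  by (auto simp: control_def factors_def intro: in_star_lang)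

lemma lstep_plain:
  assumes "set x \<subseteq> symbols"
  shows "lstep (expand trules) (map Act (map plain x)) (map Act (map plain x))"
proof -
  have "lstep (expand trules) (map Act (map plain x)) (map (\<lambda>X. X) (map Act (map plain x)))"
    by (rule lstep_singletons) (use assms in \<open>auto simp: trules_iff intro!: exI[of _ "[plain _]"]\<close>)
  then show ?thesis by simp
qed

lemma lstep_mark:
  assumes "(l, r) \<in> P"
  shows "lstep (expand trules) (map Act (map plain l)) (map Act (block (l, r)))"
proof -
  have "lstep (expand trules) (concat (map (\<lambda>i. [Act (plain (l ! i))]) [0..<length l]))
     (concat (map (\<lambda>i. [Act (NT (Mark (l, r) i))]) [0..<length l]))"
    using assms by (intro lstep_concat) (force simp: lstep_single trules_iff)
  moreover have "concat (map (\<lambda>i. [Act (plain (l ! i))]) [0..<length l]) = map Act (map plain l)"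
    using arg_cong[OF map_nth[of l], of "\<lambda>x. map Act (map plain x)"] by (simp add: comp_def)
  ultimately show ?thesis by (simp add: block_def comp_def)
qed

lemma lstep_unmark:
  assumes "(l, r) \<in> P"
  shows "lstep (expand trules) (map Act (block (l, r))) (map Act (map plain r))"
proof -
  have "lstep (expand trules) (concat (map (\<lambda>i. [Act (NT (Mark (l, r) i))]) [0..<length l]))
     (concat (map (\<lambda>i. map Act (map plain (piece (l, r) i))) [0..<length l]))"
    using assms by (intro lstep_concat) (auto simp: lstep_single trules_iff simp del: map_map)
  moreover have "concat (map (\<lambda>i. map Act (map plain (piece (l, r) i))) [0..<length l])
     = map Act (map plain (concat (map (piece (l, r)) [0..<length l])))"
    by (simp add: map_concat comp_def)
  moreover have "concat (map (piece (l, r)) [0..<length l]) = r"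
    using concat_pieces[of "(l, r)"] mono[OF assms] by simp
  ultimately show ?thesis by (simp add: block_def comp_def)
qed

text \<open>One derivation step takes two levels: marking the left-hand side, then replacing it,
  with the context copied both times.\<close>

lemma gsteps_complete:
  assumes "(derive1 P)\<^sup>*\<^sup>* [NT S] x"
  shows "(gstep trules control)\<^sup>*\<^sup>* [Act (NT Start)] (map Act (map plain x)) \<and> set x \<subseteq> symbols"
  using assms
proof (induction rule: rtranclp_induct)
  case base
  have "[NT Start] \<in> control" by (auto simp: control_def factors_def intro: in_star_lang)
  then show ?case
    by (auto simp: gstep_def lstep_single trules_iff symbols_def intro!: r_into_rtranclp exI[of _ "[plain (NT S)]"])
next
  case (step x y)
  from step.hyps(2) obtain u v l r where lr: "(l, r) \<in> P" and x: "x = u @ l @ v" and y: "y = u @ r @ v"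
    by (auto simp: derive1_def)
  have sub: "set x \<subseteq> symbols" using step.IH by blast
  have "set r \<subseteq> symbols" using lr by (force simp: symbols_def)
  then have suby: "set y \<subseteq> symbols" using sub x y by auto
  have uv: "set u \<subseteq> symbols" "set v \<subseteq> symbols" using sub x by auto
  let ?m = "map plain u @ block (l, r) @ map plain v"
  have "lstep (expand trules) (map Act (map plain x)) (map Act ?m)"
    unfolding x map_append by (intro lstep_append lstep_plain lstep_mark lr uv)
  then have 1: "gstep trules control (map Act (map plain x)) (map Act ?m)"
    using map_plain_control[OF sub] by (simp add: gstep_def del: map_map)
  have "lstep (expand trules) (map Act ?m) (map Act (map plain y))"
    unfolding y map_append by (intro lstep_append lstep_plain lstep_unmark lr uv)
  moreover have "?m \<in> control"
    using map_plain_control[OF uv(1)] map_plain_control[OF uv(2)] block_control[OF lr]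
    by (simp add: control_def append_in_star_lang)
  ultimately have 2: "gstep trules control (map Act ?m) (map Act (map plain y))"
    by (simp only: gstep_def active_map_Act simp_thms)
  from step.IH 1 2 suby show ?case by (meson rtranclp.rtrancl_into_rtrancl)
qed

lemma tree_lang_trules:
  "tree_lang trules Start control = phrase_lang P S \<union> (if erase then {[]} else {})"
proof (intro equalityI subsetI)
  fix z assume "z \<in> tree_lang trules Start control"
  then obtain g where g: "(gstep trules control)\<^sup>*\<^sup>* [Act (NT Start)] g" "map trm g = map Some z"
    by (auto simp: tree_lang_iff)
  from gsteps_sound[OF g(1)] show "z \<in> phrase_lang P S \<union> (if erase then {[]} else {})"
  proof (elim disjE exE conjE)
    fix b assume b: "g = map Act b" "(derive1 P)\<^sup>*\<^sup>* [NT S] (map (unmark S) b)"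
    have "map (trm \<circ> Act) b = map Some z \<Longrightarrow> b = map Tm z" for b :: "(('n, 't) marked, 't) sym list"
    proof (induction b arbitrary: z)
      case (Cons s b)
      then show ?case by (cases s; cases z) auto
    qed simp
    then have "b = map Tm z" using g(2) b(1) by simp
    then show ?thesis using b(2) by (simp add: phrase_lang_def comp_def)
  qed (use g(2) in auto)
next
  fix z assume "z \<in> phrase_lang P S \<union> (if erase then {[]} else {})"
  then consider "z \<in> phrase_lang P S" | "z = []" erase by (auto split: if_splits)
  then show "z \<in> tree_lang trules Start control"
  proof cases
    case 1
    then have "(derive1 P)\<^sup>*\<^sup>* [NT S] (map Tm z)" by (simp add: phrase_lang_def)
    from gsteps_complete[OF this] have
      z: "(gstep trules control)\<^sup>*\<^sup>* [Act (NT Start)] (map Act (map plain (map Tm z)))" "set (map Tm z) \<subseteq> symbols"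
      by auto
    \<comment> \<open>All wrapped terminals are released together in one last step, whose result is
      no longer subject to the control.\<close>
    have "lstep (expand trules) (map Act (map plain (map Tm z))) (map (\<lambda>a. Act (Tm a)) z)"
      using lstep_concat[of z "expand trules" "\<lambda>a. [Act (plain (Tm a))]" "\<lambda>a. [Act (Tm a)]"] z(2)
      by (force simp: lstep_single trules_iff comp_def)
    then have "gstep trules control (map Act (map plain (map Tm z))) (map (\<lambda>a. Act (Tm a)) z)"
      unfolding gstep_def active_map_Act using map_plain_control[OF z(2)] by blast
    with z(1) have "(gstep trules control)\<^sup>*\<^sup>* [Act (NT Start)] (map (\<lambda>a. Act (Tm a)) z)"
      by (rule rtranclp.rtrancl_into_rtrancl)
    then show ?thesis by (auto simp: tree_lang_iff comp_def)
  next
    case 2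
    have "[NT Start] \<in> control" by (auto simp: control_def factors_def intro: in_star_lang)
    moreover have "(Start, []) \<in> trules" unfolding trules_iff using 2(2) by blast
    ultimately have "gstep trules control [Act (NT Start)] []"
      by (simp add: gstep_def lstep_single)
    then show ?thesis using 2(1) by (auto simp: tree_lang_iff)
  qed
qed

lemma language_in_TC_UF: "phrase_lang P S \<union> (if erase then {[]} else {}) \<in> TC_UF"
proof -
  have "finite factors" using fin finite_symbols by (simp add: factors_def)
  then obtain e where e: "uf_lang e = control"
    using union_free_star_finite by (auto simp: control_def)
  have "w \<noteq> [] \<or> A = Start \<and> (\<forall>(B, v)\<in>trules. NT Start \<notin> set v)" if "(A, w) \<in> trules" for A w
  proof (cases A)
    case (Mark p i)
    then have "i < length (fst p)" "length (fst p) \<le> length (snd p)" "w = map plain (piece p i)"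
      using that mono by (auto simp: trules_iff)
    \<comment> \<open>At the last position the piece is \<open>drop i (snd p)\<close> with
      \<open>i\<close> below the length of \<open>snd p\<close>, hence nonempty.\<close>
    then show ?thesis by (simp add: piece_def)
  next
    case Start
    have "NT Start \<notin> set v" if "(B, v) \<in> trules" for B v
      using that by (cases B) (auto simp: trules_iff)
    then show ?thesis using Start by auto
  qed (use that in \<open>auto simp: trules_iff\<close>)
  from TC_UF_I[OF finite_trules this, of e] show ?thesis
    unfolding e tree_lang_trules .
qed

end

text \<open>If the erasing rule is present, \<open>S\<close> is on no right-hand side, so the rule
  applies to the sentential form \<open>[NT S]\<close> alone. What remains without it is monotone,
  and only the empty word has to be added back.\<close>

lemma CS_subset_TC_UF: "CS \<subseteq> TC_UF"
proof
  fix L :: "'t list set" assume "L \<in> CS"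
  then obtain N T P S where csg: "csg N T P S" and L: "L = phrase_lang P S"
    by (auto simp: CS_def cs_lang_def phrase_lang_def)
  define Q where "Q = {p \<in> P. snd p \<noteq> []}"
  let ?erase = "([NT S], []) \<in> P"
  have rules: "(\<exists>u A v w. w \<noteq> [] \<and> l = u @ [NT A] @ v \<and> r = u @ w @ v) \<or>
         (l = [NT S] \<and> r = [] \<and> (\<forall>(l', r') \<in> P. NT S \<notin> set r'))" if "(l, r) \<in> P" for l r
  proof -
    from csg have "\<forall>p\<in>P. case p of (l, r) \<Rightarrow> set l \<subseteq> NT ` N \<union> Tm ` T \<and> set r \<subseteq> NT ` N \<union> Tm ` T \<and>
        ((\<exists>u A v w. A \<in> N \<and> w \<noteq> [] \<and> l = u @ [NT A] @ v \<and> r = u @ w @ v) \<or>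
         (l = [NT S] \<and> r = [] \<and> (\<forall>(l', r') \<in> P. NT S \<notin> set r')))"
      unfolding csg_def by (elim conjE)
    from bspec[OF this that] show ?thesis by (simp only: prod.case) metis
  qed
  have mono: "fst p \<noteq> [] \<and> length (fst p) \<le> length (snd p)" if "p \<in> Q" for p
  proof -
    from that have "(fst p, snd p) \<in> P" "snd p \<noteq> []" by (auto simp: Q_def)
    from rules[OF this(1)] this(2) obtain u A v w where
      "w \<noteq> []" "fst p = u @ [NT A] @ v" "snd p = u @ w @ v" by blast
    then show ?thesis by (cases w) auto
  qed
  interpret monotone_grammar Q S ?erase
    using mono csg by unfold_locales (auto simp: csg_def Q_def)
  have "derive1 Q \<le> derive1 P" unfolding derive1_def Q_def by blast
  then have QP: "phrase_lang Q S \<subseteq> phrase_lang P S"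
    using rtranclp_mono[of "derive1 Q" "derive1 P"] by (auto simp: phrase_lang_def)
  have "phrase_lang P S = phrase_lang Q S \<union> (if ?erase then {[]} else {})"
  proof (cases ?erase)
    case False
    have "Q = P" using rules False by (fastforce simp: Q_def)
    then show ?thesis using False by simp
  next
    case True
    then have noS: "NT S \<notin> set r" if "(l, r) \<in> P" for l r
      using rules[OF True] that by auto
    have lne: "l \<noteq> []" if "(l, r) \<in> P" for l r using rules[OF that] by auto
    \<comment> \<open>Either the erasing rule has been applied and nothing is left, or the
      derivation stays within \<open>Q\<close> and \<open>S\<close> is gone after its first
      step.\<close>
    have inv: "x = [] \<or> ((derive1 Q)\<^sup>*\<^sup>* [NT S] x \<and> (x = [NT S] \<or> NT S \<notin> set x))"
      if "(derive1 P)\<^sup>*\<^sup>* [NT S] x" for x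
      using that
    proof (induction rule: rtranclp_induct)
      case (step x y)
      from step.hyps(2) obtain u v l r where lr: "(l, r) \<in> P" and x: "x = u @ l @ v" and y: "y = u @ r @ v"
        by (auto simp: derive1_def)
      have xne: "x \<noteq> []" using lne[OF lr] x by simp
      show ?case
      proof (cases "r = []")
        case True
        then have "l = [NT S]" using rules[OF lr] by auto
        then have "x = [NT S]" using step.IH xne x by auto
        then show ?thesis using \<open>l = [NT S]\<close> x y True by (cases u) auto
      next
        case False
        then have "derive1 Q x y" using lr x y by (auto simp: Q_def derive1_def)
        moreover have "NT S \<notin> set y"
        proof (cases "x = [NT S]")
          case True
          then have "u = [] \<and> v = []" using lne[OF lr] x by (cases u; cases l) auto
          then show ?thesis using noS[OF lr] y by simp
        next
          case False
          then show ?thesis using step.IH xne x y noS[OF lr] by auto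
        qed
        ultimately show ?thesis using step.IH xne by (auto intro: rtranclp.rtrancl_into_rtrancl)
      qed
    qed simp
    have "(derive1 P)\<^sup>*\<^sup>* [NT S] []" using derive1_rule[OF True] by blast
    then have "[] \<in> phrase_lang P S" by (simp add: phrase_lang_def)
    moreover have "z \<in> phrase_lang Q S \<or> z = []" if "z \<in> phrase_lang P S" for z
      using inv[of "map Tm z"] that by (auto simp: phrase_lang_def)
    ultimately show ?thesis using True QP by auto
  qed
  then show "L \<in> TC_UF" using language_in_TC_UF L by simp
qed

section \<open>Residuals of regular languages\<close>

definition residual :: "'a list \<Rightarrow> 'a list set \<Rightarrow> 'a list set" where
  "residual w L = {v. w @ v \<in> L}"

text \<open>The left quotients of the language, that is, the states of its minimal complete
  deterministic automaton (Myhill-Nerode).\<close>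

definition residuals :: "'a list set \<Rightarrow> 'a list set set" where
  "residuals L = range (\<lambda>w. residual w L)"

text \<open>Either \<open>w\<close> ends within the factor from \<open>A\<close>, or a prefix of
  \<open>w\<close> is that factor and the rest is cut from the factor in \<open>B\<close>. This is
  Brzozowski's derivative for a whole word.\<close>

lemma residual_conc:
  "residual w (conc_lang A B) = conc_lang (residual w A) B \<union> \<Union>{residual v B | u v. u \<in> A \<and> w = u @ v}"
proof (intro equalityI subsetI)
  fix x assume "x \<in> residual w (conc_lang A B)"
  then obtain a b where ab: "w @ x = a @ b" "a \<in> A" "b \<in> B" by (auto simp: residual_def conc_lang_def)
  then consider c where "w = a @ c" "c @ x = b" | c where "a = w @ c" "x = c @ b"
    by (auto simp: append_eq_append_conv2)
  then show "x \<in> conc_lang (residual w A) B \<union> \<Union>{residual v B | u v. u \<in> A \<and> w = u @ v}"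
  proof cases
    case 1
    then have "x \<in> residual c B" using ab by (simp add: residual_def)
    then show ?thesis using 1 ab by blast
  qed (use ab in \<open>auto simp: residual_def conc_lang_def\<close>)
next
  fix x assume "x \<in> conc_lang (residual w A) B \<union> \<Union>{residual v B | u v. u \<in> A \<and> w = u @ v}"
  then show "x \<in> residual w (conc_lang A B)"
  proof
    assume "x \<in> conc_lang (residual w A) B"
    then obtain u v where "x = u @ v" "w @ u \<in> A" "v \<in> B" by (auto simp: residual_def conc_lang_def)
    then have "w @ x = (w @ u) @ v" "w @ u \<in> A" "v \<in> B" by auto
    then show ?thesis unfolding residual_def conc_lang_def by blast
  next
    assume "x \<in> \<Union>{residual v B | u v. u \<in> A \<and> w = u @ v}"
    then obtain u v where "v @ x \<in> B" "u \<in> A" "w @ x = u @ (v @ x)" by (auto simp: residual_def)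
    then show ?thesis unfolding residual_def conc_lang_def by blast
  qed
qed

text \<open>The cut is charged to the factor that contains the last letter of \<open>w\<close>,
  which exists because \<open>w\<close> is nonempty. If the cut falls between two factors,
  \<open>v1\<close> is empty.\<close>

lemma star_lang_split:
  assumes "w \<noteq> []" "w @ v = concat ws" "set ws \<subseteq> A"
  shows "\<exists>x y v1 v2. w = x @ y \<and> v = v1 @ v2 \<and> x \<in> star_lang A \<and> y @ v1 \<in> A \<and> v2 \<in> star_lang A"
  using assms
proof (induction ws arbitrary: w)
  case (Cons c cs)
  have cs: "concat cs \<in> star_lang A" using Cons.prems(3) by (auto simp: star_lang_def)
  from Cons.prems(2) consider d where "c = w @ d" "v = d @ concat cs" | d where "w = c @ d" "d @ v = concat cs"
    by (auto simp: append_eq_append_conv2)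
  then show ?case
  proof cases
    case 1
    then show ?thesis using Cons.prems(3) cs Nil_in_star_lang
      by (intro exI[of _ "[]"] exI[of _ w] exI[of _ d] exI[of _ "concat cs"]) auto
  next
    case 2
    show ?thesis
    proof (cases "d = []")
      case True
      then show ?thesis using 2 Cons.prems(3) cs Nil_in_star_lang
        by (intro exI[of _ "[]"] exI[of _ c] exI[of _ "[]"] exI[of _ "concat cs"]) auto
    next
      case False
      then obtain x y v1 v2 where
        "d = x @ y" "v = v1 @ v2" "x \<in> star_lang A" "y @ v1 \<in> A" "v2 \<in> star_lang A"
        using Cons.IH[OF _ 2(2)] Cons.prems(3) by auto
      moreover have "c @ x \<in> star_lang A"
        using append_in_star_lang[OF in_star_lang calculation(3), of c] Cons.prems(3) by simp
      ultimately show ?thesis using 2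
        by (intro exI[of _ "c @ x"] exI[of _ y] exI[of _ v1] exI[of _ v2]) auto
    qed
  qed
qed auto

text \<open>For empty \<open>w\<close> the right-hand side would be
  \<open>conc_lang A (star_lang A)\<close>, which may miss the empty word.\<close>

lemma residual_star:
  assumes "w \<noteq> []"
  shows "residual w (star_lang A)
    = \<Union>{conc_lang (residual y A) (star_lang A) | x y. w = x @ y \<and> x \<in> star_lang A}"
proof (intro equalityI subsetI)
  fix v assume "v \<in> residual w (star_lang A)"
  then obtain ws where "w @ v = concat ws" "set ws \<subseteq> A" by (auto simp: residual_def star_lang_def)
  from star_lang_split[OF assms this] obtain x y v1 v2 where
    *: "w = x @ y" "v = v1 @ v2" "x \<in> star_lang A" "y @ v1 \<in> A" "v2 \<in> star_lang A" by blast
  then have "v \<in> conc_lang (residual y A) (star_lang A)" by (auto simp: conc_lang_def residual_def)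
  then show "v \<in> \<Union>{conc_lang (residual y A) (star_lang A) | x y. w = x @ y \<and> x \<in> star_lang A}"
    using * by blast
next
  fix v assume "v \<in> \<Union>{conc_lang (residual y A) (star_lang A) | x y. w = x @ y \<and> x \<in> star_lang A}"
  then obtain x y v1 v2 where
    "w = x @ y" "x \<in> star_lang A" "v = v1 @ v2" "y @ v1 \<in> A" "v2 \<in> star_lang A"
    by (auto simp: conc_lang_def residual_def)
  then have "w @ v = x @ (y @ v1) @ v2" "x \<in> star_lang A" "y @ v1 \<in> star_lang A" "v2 \<in> star_lang A"
    by (simp_all add: in_star_lang)
  then have "w @ v \<in> star_lang A" using append_in_star_lang by metis
  then show "v \<in> residual w (star_lang A)" by (simp add: residual_def)
qed

text \<open>A residual of a product is determined by one residual of the left factor and a set of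
  residuals of the right one; a residual of a star, other than the star itself, by a set of
  residuals of its base.\<close>

lemma finite_residuals_uf_lang: "finite (residuals (uf_lang e))"
proof (induction e)
  case UEmpty
  then show ?case by (simp add: residuals_def residual_def)
next
  case (USym a)
  have "residual w {[a]} \<in> {{[a]}, {[]}, {}}" for w
    by (cases w) (auto simp: residual_def)
  then have "residuals {[a]} \<subseteq> {{[a]}, {[]}, {}}" by (auto simp: residuals_def)
  then show ?case by (simp add: finite_subset)
next
  case (UConc e f)
  let ?A = "uf_lang e" and ?B = "uf_lang f"
  have "residuals (conc_lang ?A ?B) \<subseteq>
    (\<lambda>(X, Y). conc_lang X ?B \<union> \<Union>Y) ` (residuals ?A \<times> Pow (residuals ?B))"
  proof
    fix Z assume "Z \<in> residuals (conc_lang ?A ?B)"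
    then obtain w where "Z = residual w (conc_lang ?A ?B)" by (auto simp: residuals_def)
    then have "Z = (\<lambda>(X, Y). conc_lang X ?B \<union> \<Union>Y) (residual w ?A, {residual v ?B | u v. u \<in> ?A \<and> w = u @ v})"
      by (simp add: residual_conc)
    then show "Z \<in> (\<lambda>(X, Y). conc_lang X ?B \<union> \<Union>Y) ` (residuals ?A \<times> Pow (residuals ?B))"
      by (rule image_eqI) (auto simp: residuals_def)
  qed
  then show ?case using UConc by (auto intro: finite_subset)
next
  case (UStar e)
  let ?A = "uf_lang e"
  have "residuals (star_lang ?A) \<subseteq>
    insert (star_lang ?A) (Union ` Pow ((\<lambda>X. conc_lang X (star_lang ?A)) ` residuals ?A))"
  proof
    fix Z assume "Z \<in> residuals (star_lang ?A)"
    then obtain w where Z: "Z = residual w (star_lang ?A)" by (auto simp: residuals_def)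
    show "Z \<in> insert (star_lang ?A) (Union ` Pow ((\<lambda>X. conc_lang X (star_lang ?A)) ` residuals ?A))"
    proof (cases "w = []")
      case False
      then show ?thesis unfolding Z residual_star[OF False]
        by (intro insertI2 imageI) (auto simp: residuals_def)
    qed (simp add: Z residual_def)
  qed
  then show ?case using UStar by (auto intro: finite_subset)
qed

section \<open>Simulating level rewriting by context-sensitive rules\<close>

text \<open>The flag of a cell is the parity of its level, so that the return sweep, which turns
  \<open>Done p\<close> into \<open>Ready (\<not> p)\<close>, cannot start from cells of the old level that are still \<open>Ready p\<close>.\<close>

datatype ('c, 'q) cell = Init | Ready bool 'c | Done bool 'c 'q

abbreviation rd :: "bool \<Rightarrow> 'c \<Rightarrow> (('c, 'q) cell, 't) sym" where
  "rd p X \<equiv> NT (Ready p X)"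

fun dn :: "bool \<Rightarrow> 'c \<times> 'q \<Rightarrow> (('c, 'q) cell, 't) sym" where
  "dn p (X, q) = NT (Done p X q)"

text \<open>Every left-hand side except that of the initial rules will end in a ready cell. Its
  place of application is found here: that cell cannot lie in \<open>z\<close>, which has no ready
  cells.\<close>

lemma split_at_ready:
  assumes "z @ map (rd p) b = x @ rd p' X # y" "\<And>p X. rd p X \<notin> set z"
  shows "\<exists>b1 b2. b = b1 @ X # b2 \<and> p' = p \<and> x = z @ map (rd p) b1 \<and> y = map (rd p) b2"
  using assms
proof (induction z arbitrary: x)
  case Nil
  then show ?case by (auto simp: map_eq_append_conv map_eq_Cons_conv)
next
  case (Cons s z)
  then obtain x' where "x = s # x'" by (cases x) auto
  with Cons show ?case by auto
qed

text \<open>A parallel system whose words are tested by the automaton \<open>delta\<close>. By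
  \<open>flags\<close>, a letter of a reachable word shows by itself whether it is first or last;
  reachability is spelled out there because \<open>ustep\<close> is defined only below.\<close>

locale level_system =
  fixes ex :: "'c \<Rightarrow> 'c list set" and c0 :: 'c and isfirst islast :: "'c \<Rightarrow> bool"
    and tm :: "'c \<Rightarrow> 't option" and delta :: "'q \<Rightarrow> 'c \<Rightarrow> 'q" and q0 :: 'q and acc :: "'q \<Rightarrow> bool"
    and C :: "'c set" and Q :: "'q set" and erase :: bool
  assumes finC: "finite C" and finQ: "finite Q" and c0: "c0 \<in> C" and q0: "q0 \<in> Q"
    and delta_closed: "\<And>q X. q \<in> Q \<Longrightarrow> X \<in> C \<Longrightarrow> delta q X \<in> Q"
    and ex_fin: "\<And>X. X \<in> C \<Longrightarrow> finite (ex X)"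
    and ex_closed: "\<And>X w. X \<in> C \<Longrightarrow> w \<in> ex X \<Longrightarrow> set w \<subseteq> C"
    and ex_nonempty: "\<And>X w. w \<in> ex X \<Longrightarrow> w \<noteq> []"
    and flags: "\<And>g u X v. (\<lambda>g h. acc (foldl delta q0 g) \<and> lstep ex g h)\<^sup>*\<^sup>* [c0] g \<Longrightarrow> g = u @ X # v \<Longrightarrow>
      (isfirst X \<longleftrightarrow> u = []) \<and> (islast X \<longleftrightarrow> v = [])"
begin

section \<open>Context-sensitive rules for one level step\<close>

definition ustep :: "'c list \<Rightarrow> 'c list \<Rightarrow> bool" where
  "ustep g h \<longleftrightarrow> acc (foldl delta q0 g) \<and> lstep ex g h"

abbreviation reach :: "'c list \<Rightarrow> bool" where
  "reach \<equiv> ustep\<^sup>*\<^sup>* [c0]"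

lemma reach_flags: "reach g \<Longrightarrow> g = u @ X # v \<Longrightarrow> (isfirst X \<longleftrightarrow> u = []) \<and> (islast X \<longleftrightarrow> v = [])"
  using flags unfolding ustep_def[abs_def] by blast

lemma lstep_empty: "lstep ex g [] \<Longrightarrow> g = []"
  by (cases g) (auto elim!: lstep_ConsE dest: ex_nonempty)

lemma lstep_closed: "lstep ex g h \<Longrightarrow> set g \<subseteq> C \<Longrightarrow> set h \<subseteq> C"
  by (induction rule: lstep.induct) (use ex_closed in auto)

lemma reach_closed: "reach g \<Longrightarrow> g \<noteq> [] \<and> set g \<subseteq> C"
proof (induction rule: rtranclp_induct)
  case (step g h)
  then show ?case using lstep_closed lstep_empty by (auto simp: ustep_def)
qed (simp add: c0)

text \<open>A first letter starts in \<open>q0\<close> without a neighbour. Any other letter takes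
  its state from the done cell on its left, so the sweep cannot skip a letter.\<close>

definition lefts :: "bool \<Rightarrow> 'c \<Rightarrow> 'q \<Rightarrow> (('c, 'q) cell, 't) sym list set" where
  "lefts p X q = (if isfirst X then {u. u = [] \<and> q = q0} else (\<lambda>Y. [dn p (Y, q)]) ` C)"

text \<open>All letters produced by \<open>X\<close> store the state after \<open>X\<close>, a state
  of the level being read and not of the one being written. The last letter yields ready cells at
  once, and there the return sweep begins.\<close>

definition out :: "bool \<Rightarrow> 'c \<Rightarrow> 'q \<Rightarrow> 'c list \<Rightarrow> (('c, 'q) cell, 't) sym list" where
  "out p X q w = (if islast X then map (rd (\<not> p)) w else map (\<lambda>Y. dn p (Y, delta q X)) w)"

definition sweep_rules :: "((('c, 'q) cell, 't) sym list \<times> (('c, 'q) cell, 't) sym list) set" where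
  "sweep_rules = (\<Union>p. \<Union>X\<in>C. \<Union>q\<in>Q. \<Union>w\<in>ex X. \<Union>u\<in>lefts p X q.
     {(l, r). l = u @ [rd p X] \<and> r = u @ out p X q w \<and> (islast X \<longrightarrow> acc (delta q X))})"

definition return_rules :: "((('c, 'q) cell, 't) sym list \<times> (('c, 'q) cell, 't) sym list) set" where
  "return_rules = (\<Union>p. \<Union>X\<in>C. \<Union>q\<in>Q. \<Union>Y\<in>C. {([dn p (X, q), rd (\<not> p) Y], [rd (\<not> p) X, rd (\<not> p) Y])})"

text \<open>Terminals are released from the left, so the first cell goes first and no sweep can
  start afterwards. Ranging over \<open>Y\<close> restricts \<open>b\<close> to finitely many
  terminals.\<close>

definition final_rules :: "((('c, 'q) cell, 't) sym list \<times> (('c, 'q) cell, 't) sym list) set" where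
  "final_rules = (\<Union>p. \<Union>X\<in>C. {([rd p X], [Tm a]) | a. isfirst X \<and> tm X = Some a} \<union>
     (\<Union>Y\<in>C. {([Tm b, rd p X], [Tm b, Tm a]) | a b. \<not> isfirst X \<and> tm Y = Some b \<and> tm X = Some a}))"

definition init_rules :: "((('c, 'q) cell, 't) sym list \<times> (('c, 'q) cell, 't) sym list) set" where
  "init_rules = insert ([NT Init], [rd True c0]) (if erase then {([NT Init], [])} else {})"

definition rules :: "((('c, 'q) cell, 't) sym list \<times> (('c, 'q) cell, 't) sym list) set" where
  "rules = init_rules \<union> sweep_rules \<union> return_rules \<union> final_rules"

lemma finite_rules: "finite rules"
proof -
  have 1: "finite {(l, r). l = l0 \<and> r = r0 \<and> b}" for l0 r0 :: "(('c, 'q) cell, 't) sym list" and b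
    by (rule finite_subset[of _ "{(l0, r0)}"]) auto
  have 2: "finite (lefts p X q)" for p X q using finC by (simp add: lefts_def)
  have "finite sweep_rules"
    unfolding sweep_rules_def using finC finQ ex_fin 1 2 by (intro finite_UN_I) auto
  moreover have "finite return_rules"
    unfolding return_rules_def using finC finQ by auto
  moreover have "finite final_rules"
  proof -
    have "finite {([rd p X] :: (('c, 'q) cell, 't) sym list, [Tm a]) | a. isfirst X \<and> tm X = Some a}" for p X
      by (rule finite_subset[of _ "{([rd p X], [Tm (the (tm X))])}"]) auto
    moreover have "finite {([Tm b, rd p X] :: (('c, 'q) cell, 't) sym list, [Tm b, Tm a]) | a b.
        \<not> isfirst X \<and> tm Y = Some b \<and> tm X = Some a}" for p X Y
      by (rule finite_subset[of _ "{([Tm (the (tm Y)), rd p X], [Tm (the (tm Y)), Tm (the (tm X))])}"]) auto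
    ultimately show ?thesis unfolding final_rules_def using finC by auto
  qed
  ultimately show ?thesis by (simp add: rules_def init_rules_def)
qed

section \<open>Soundness: the three shapes of a sentential form\<close>

lemma dn_eq: "dn p x = NT (Done p (fst x) (snd x))"
  by (cases x) simp

text \<open>\<open>a\<close> has been read, \<open>b\<close> has not. With \<open>D = []\<close> the
  level is at rest, and either a sweep or the release of terminals may start.\<close>

definition forward :: "bool \<Rightarrow> 'c list \<Rightarrow> (('c, 'q) cell, 't) sym list \<Rightarrow> bool" where
  "forward p g s \<longleftrightarrow> (\<exists>a b D. g = a @ b \<and> b \<noteq> [] \<and> s = map (dn p) D @ map (rd p) b \<and>
     lstep ex a (map fst D) \<and> (D \<noteq> [] \<longrightarrow> snd (last D) = foldl delta q0 a))"

text \<open>Here \<open>g\<close> is already the new level, because the old one was accepted before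
  any return rule could apply. \<open>D\<close> is nonempty since otherwise the word is a forward
  form of the other parity.\<close>

definition backward :: "bool \<Rightarrow> 'c list \<Rightarrow> (('c, 'q) cell, 't) sym list \<Rightarrow> bool" where
  "backward p g s \<longleftrightarrow> (\<exists>b D. g = map fst D @ b \<and> D \<noteq> [] \<and> b \<noteq> [] \<and> s = map (dn p) D @ map (rd (\<not> p)) b)"

definition finishing :: "bool \<Rightarrow> 'c list \<Rightarrow> (('c, 'q) cell, 't) sym list \<Rightarrow> bool" where
  "finishing p g s \<longleftrightarrow> (\<exists>a b z. g = a @ b \<and> a \<noteq> [] \<and> s = map Tm z @ map (rd p) b \<and> map tm a = map Some z)"

definition inv :: "(('c, 'q) cell, 't) sym list \<Rightarrow> bool" where
  "inv s \<longleftrightarrow> (\<exists>p g. reach g \<and> (forward p g s \<or> backward p g s \<or> finishing p g s))"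

lemma forward_start: "g \<noteq> [] \<Longrightarrow> forward p g (map (rd p) g)"
  unfolding forward_def by (intro exI[of _ "[]"] exI[of _ g]) (auto intro: lstep_Nil)

lemma backward_inv:
  assumes "g = map fst D @ b" "b \<noteq> []" "reach g"
  shows "inv (map (dn p) D @ map (rd (\<not> p)) b)"
proof (cases "D = []")
  case True
  then show ?thesis using assms forward_start[of b "\<not> p"] by (auto simp: inv_def)
next
  case False
  then have "backward p g (map (dn p) D @ map (rd (\<not> p)) b)" using assms by (auto simp: backward_def)
  then show ?thesis using assms(3) by (auto simp: inv_def)
qed

lemma forward_step:
  assumes g: "reach g" and fw: "forward p g (x @ l @ y)" and lr: "(l, r) \<in> rules"
  shows "inv (x @ r @ y)"
proof -
  from fw obtain a b D where ab: "g = a @ b" "b \<noteq> []" "x @ l @ y = map (dn p) D @ map (rd p) b"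
     "lstep ex a (map fst D)" "D \<noteq> [] \<Longrightarrow> snd (last D) = foldl delta q0 a"
    unfolding forward_def by metis
  have nr: "rd p' X \<notin> set (map (dn p) D)" for p' X by (auto simp: dn_eq)
  have split: "\<exists>b1 b2. b = b1 @ X # b2 \<and> p' = p \<and> x @ u = map (dn p) D @ map (rd p) b1 \<and> y = map (rd p) b2"
    if "l = u @ [rd p' X]" for u p' X
  proof -
    have "map (dn p) D @ map (rd p) b = (x @ u) @ rd p' X # y" using ab(3) that by simp
    from split_at_ready[OF this nr] show ?thesis .
  qed
  consider "(l, r) \<in> init_rules" | "(l, r) \<in> sweep_rules" | "(l, r) \<in> return_rules" | "(l, r) \<in> final_rules"
    using lr by (auto simp: rules_def)
  then show ?thesis
  proof cases
    case 1
    then have "NT Init \<in> set (x @ l @ y)" by (auto simp: init_rules_def split: if_splits)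
    then show ?thesis unfolding ab(3) by (auto simp: dn_eq)
  next
    case 2
    then obtain p' X q w u where *: "X \<in> C" "w \<in> ex X" "u \<in> lefts p' X q" "l = u @ [rd p' X]"
      "r = u @ out p' X q w" "islast X \<longrightarrow> acc (delta q X)"
      by (auto simp: sweep_rules_def)
    from split[OF *(4)] obtain b1 b2 where b: "b = b1 @ X # b2" "p' = p" "x @ u = map (dn p) D @ map (rd p) b1"
      "y = map (rd p) b2" by blast
    have fl: "(isfirst X \<longleftrightarrow> a @ b1 = []) \<and> (islast X \<longleftrightarrow> b2 = [])"
      using reach_flags[OF g, of "a @ b1" X b2] ab(1) b(1) by simp
    \<comment> \<open>The rewritten cell is the first unread one: it is flagged first, or its left
      neighbour is a done cell and thus the end of \<open>D\<close>, which also determines the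
      state.\<close>
    have key: "b1 = [] \<and> q = foldl delta q0 a"
    proof (cases "isfirst X")
      case True
      then show ?thesis using fl *(3) by (simp add: lefts_def)
    next
      case False
      then obtain Y where u: "u = [dn p (Y, q)]" using *(3) b(2) by (auto simp: lefts_def)
      have "b1 = []"
      proof (rule ccontr)
        assume "b1 \<noteq> []"
        then have "last (map (dn p) D @ map (rd p) b1) = (rd p (last b1) :: (('c, 'q) cell, 't) sym)"
          by (simp add: last_map)
        then show False using arg_cong[OF b(3), of last] u by simp
      qed
      then have eq: "x @ [dn p (Y, q)] = map (dn p) D" using b(3) u by simp
      then have D: "D \<noteq> []" by (cases D) auto
      have "last (map (dn p) D) = (dn p (Y, q) :: (('c, 'q) cell, 't) sym)"
        using arg_cong[OF eq, of last] by simp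
      then have "dn p (last D) = (dn p (Y, q) :: (('c, 'q) cell, 't) sym)" using D by (simp add: last_map)
      then have "snd (last D) = q" by (simp add: dn_eq)
      then show ?thesis using ab(5)[OF D] \<open>b1 = []\<close> by simp
    qed
    then have s: "x @ r @ y = map (dn p) D @ out p X q w @ map (rd p) b2"
      using b *(5) by simp
    have wne: "w \<noteq> []" using ex_nonempty *(2) by blast
    have st: "lstep ex (a @ [X]) (map fst D @ w)"
      using ab(4) *(2) by (auto intro!: lstep_append simp: lstep_single)
    show ?thesis
    proof (cases "islast X")
      case True
      then have "b2 = []" "g = a @ [X]" using fl ab b key by auto
      \<comment> \<open>The acceptance test in the rule for the last cell is the control condition
        on the level just read.\<close>
      then have "ustep g (map fst D @ w)" using st True *(6) key by (simp add: ustep_def)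
      then have "reach (map fst D @ w)" using g by simp
      then show ?thesis using backward_inv[OF refl wne] s True \<open>b2 = []\<close> by (simp add: out_def)
    next
      case False
      let ?D = "D @ map (\<lambda>Y. (Y, delta q X)) w"
      have "forward p g (x @ r @ y)"
        unfolding forward_def
      proof (intro exI conjI)
        show "g = (a @ [X]) @ b2" using ab b key by simp
        show "b2 \<noteq> []" using False fl by simp
        show "x @ r @ y = map (dn p) ?D @ map (rd p) b2" using s False by (simp add: out_def)
        show "lstep ex (a @ [X]) (map fst ?D)" using st by (simp add: comp_def)
        show "?D \<noteq> [] \<longrightarrow> snd (last ?D) = foldl delta q0 (a @ [X])"
          using wne key by (simp add: last_map)
      qed
      then show ?thesis using g by (auto simp: inv_def)
    qed
  next
    case 3
    then obtain p' X q Y where *: "l = [dn p' (X, q)] @ [rd (\<not> p') Y]" by (auto simp: return_rules_def)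
    \<comment> \<open>A return rule needs opposite parities, but in a forward form done and ready
      cells share theirs.\<close>
    from split[OF *] obtain b1 where "(\<not> p') = p" "x @ [dn p' (X, q)] = map (dn p) D @ map (rd p) b1"
      by blast
    then have "dn p' (X, q) \<in> set (map (dn p) D @ map (rd p) b1 :: (('c, 'q) cell, 't) sym list)" "p' \<noteq> p"
      by (metis in_set_conv_decomp, blast)
    then show ?thesis by (auto simp: dn_eq)
  next
    case 4
    then consider p' X c where "l = [] @ [rd p' X]" "r = [Tm c]" "isfirst X" "tm X = Some c"
      | p' X e where "l = [Tm e] @ [rd p' X]" by (auto simp: final_rules_def)
    then show ?thesis
    proof cases
      case 1
      from split[OF 1(1)] obtain b1 b2 where b: "b = b1 @ X # b2" "p' = p"
        "x = map (dn p) D @ map (rd p) b1" "y = map (rd p) b2" by auto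
      \<comment> \<open>Only a sweep that has not begun leaves the first cell ready.\<close>
      have "a @ b1 = []" using reach_flags[OF g, of "a @ b1" X b2] ab(1) b(1) 1(3) by simp
      then have "D = []" "b1 = []" "a = []" using ab(4) by (auto elim: lstep_NilE)
      then have "finishing p g (x @ r @ y)"
        unfolding finishing_def using ab b 1
        by (intro exI[of _ "[X]"] exI[of _ b2] exI[of _ "[c]"]) auto
      then show ?thesis using g by (auto simp: inv_def)
    next
      case 2
      from split[OF this] obtain b1 where "x @ [Tm e] = map (dn p) D @ map (rd p) b1" by blast
      then have "Tm e \<in> set (map (dn p) D @ map (rd p) b1 :: (('c, 'q) cell, 't) sym list)"
        by (metis in_set_conv_decomp)
      then show ?thesis by (auto simp: dn_eq)
    qed
  qed
qed

text \<open>Only a return rule at the border can apply: the first cell is still done, a sweep rule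
  further right wants equal parities of done and ready cells, and there are no terminals
  yet.\<close>

lemma backward_step:
  assumes g: "reach g" and bw: "backward p g (x @ l @ y)" and lr: "(l, r) \<in> rules"
  shows "inv (x @ r @ y)"
proof -
  from bw obtain b D where ab: "g = map fst D @ b" "D \<noteq> []" "b \<noteq> []"
     "x @ l @ y = map (dn p) D @ map (rd (\<not> p)) b"
    unfolding backward_def by metis
  have nr: "rd p' X \<notin> set (map (dn p) D)" for p' X by (auto simp: dn_eq)
  have split: "\<exists>b1 b2. b = b1 @ X # b2 \<and> p' = (\<not> p) \<and> x @ u = map (dn p) D @ map (rd (\<not> p)) b1 \<and> y = map (rd (\<not> p)) b2"
    if "l = u @ [rd p' X]" for u p' X
  proof -
    have "map (dn p) D @ map (rd (\<not> p)) b = (x @ u) @ rd p' X # y" using ab(4) that by simp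
    from split_at_ready[OF this nr] show ?thesis .
  qed
  have notfirst: "\<not> isfirst X" if "l = u @ [rd p' X]" for u p' X
  proof -
    from split[OF that] obtain b1 b2 where "b = b1 @ X # b2" by blast
    then show ?thesis using reach_flags[OF g, of "map fst D @ b1" X b2] ab(1,2) by simp
  qed
  consider "(l, r) \<in> init_rules" | "(l, r) \<in> sweep_rules" | "(l, r) \<in> return_rules" | "(l, r) \<in> final_rules"
    using lr by (auto simp: rules_def)
  then show ?thesis
  proof cases
    case 1
    then have "NT Init \<in> set (x @ l @ y)" by (auto simp: init_rules_def split: if_splits)
    then show ?thesis unfolding ab(4) by (auto simp: dn_eq)
  next
    case 2
    then obtain p' X q w u where *: "u \<in> lefts p' X q" "l = u @ [rd p' X]"
      by (auto simp: sweep_rules_def)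
    then obtain Y where u: "u = [dn p' (Y, q)]" using notfirst[OF *(2)] by (auto simp: lefts_def)
    from split[OF *(2)] obtain b1 where b: "p' = (\<not> p)" "x @ u = map (dn p) D @ map (rd (\<not> p)) b1" by blast
    then have "dn p' (Y, q) \<in> set (map (dn p) D @ map (rd (\<not> p)) b1 :: (('c, 'q) cell, 't) sym list)" "p' \<noteq> p"
      unfolding u by (metis in_set_conv_decomp, blast)
    then show ?thesis by (auto simp: dn_eq)
  next
    case 3
    then obtain p' X q Y where *: "l = [dn p' (X, q)] @ [rd (\<not> p') Y]" "r = [rd (\<not> p') X, rd (\<not> p') Y]"
      by (auto simp: return_rules_def)
    from split[OF *(1)] obtain b1 b2 where b: "b = b1 @ Y # b2" "p' = p"
      "x @ [dn p' (X, q)] = map (dn p) D @ map (rd (\<not> p)) b1" "y = map (rd (\<not> p)) b2" by blast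
    have "b1 = []"
    proof (rule ccontr)
      assume "b1 \<noteq> []"
      then have "last (map (dn p) D @ map (rd (\<not> p)) b1) = (rd (\<not> p) (last b1) :: (('c, 'q) cell, 't) sym)"
        by (simp add: last_map)
      then show False using arg_cong[OF b(3), of last] by simp
    qed
    then have "map (dn p) D = x @ [dn p (X, q)]" using b by simp
    then obtain D' d where D: "D = D' @ [d]" "x = map (dn p) D'" "dn p d = (dn p (X, q) :: (('c, 'q) cell, 't) sym)"
      by (auto simp: map_eq_append_conv)
    then have "d = (X, q)" by (cases d) simp
    then have "g = map fst D' @ (X # b)" "x @ r @ y = map (dn p) D' @ map (rd (\<not> p)) (X # b)"
      using ab(1) D b * \<open>b1 = []\<close> by auto
    then show ?thesis using backward_inv[of g D' "X # b" p] g by simp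
  next
    case 4
    then consider p' X where "l = [] @ [rd p' X]" "isfirst X"
      | p' X e where "l = [Tm e] @ [rd p' X]" by (auto simp: final_rules_def)
    then show ?thesis
    proof cases
      case 1
      then show ?thesis using notfirst by blast
    next
      case 2
      from split[OF this] obtain b1 where "x @ [Tm e] = map (dn p) D @ map (rd (\<not> p)) b1" by blast
      then have "Tm e \<in> set (map (dn p) D @ map (rd (\<not> p)) b1 :: (('c, 'q) cell, 't) sym list)"
        by (metis in_set_conv_decomp)
      then show ?thesis by (auto simp: dn_eq)
    qed
  qed
qed

text \<open>No cell is done and no ready cell is first any more, so neither sweep can start and the
  current level is the final one.\<close>

lemma finishing_step:
  assumes g: "reach g" and fi: "finishing p g (x @ l @ y)" and lr: "(l, r) \<in> rules"
  shows "inv (x @ r @ y)"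
proof -
  from fi obtain a b z where ab: "g = a @ b" "a \<noteq> []"
     "x @ l @ y = map Tm z @ map (rd p) b" "map tm a = map Some z"
    unfolding finishing_def by metis
  have nr: "rd p' X \<notin> set (map Tm z)" for p' X by auto
  have split: "\<exists>b1 b2. b = b1 @ X # b2 \<and> p' = p \<and> x @ u = map Tm z @ map (rd p) b1 \<and> y = map (rd p) b2"
    if "l = u @ [rd p' X]" for u p' X
  proof -
    have "map Tm z @ map (rd p) b = (x @ u) @ rd p' X # y" using ab(3) that by simp
    from split_at_ready[OF this nr] show ?thesis .
  qed
  have notfirst: "\<not> isfirst X" if "l = u @ [rd p' X]" for u p' X
  proof -
    from split[OF that] obtain b1 b2 where "b = b1 @ X # b2" by blast
    then show ?thesis using reach_flags[OF g, of "a @ b1" X b2] ab(1,2) by simp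
  qed
  have nodone: "dn p' d \<notin> set l" for p' d
  proof
    assume "dn p' d \<in> set l"
    then have "dn p' d \<in> set (x @ l @ y)" by simp
    then show False unfolding ab(3) by (auto simp: dn_eq)
  qed
  consider "(l, r) \<in> init_rules" | "(l, r) \<in> sweep_rules" | "(l, r) \<in> return_rules" | "(l, r) \<in> final_rules"
    using lr by (auto simp: rules_def)
  then show ?thesis
  proof cases
    case 1
    then have "NT Init \<in> set (x @ l @ y)" by (auto simp: init_rules_def split: if_splits)
    then show ?thesis unfolding ab(3) by auto
  next
    case 2
    then obtain p' X q w u where *: "u \<in> lefts p' X q" "l = u @ [rd p' X]"
      by (auto simp: sweep_rules_def)
    then obtain Y where "u = [dn p' (Y, q)]" using notfirst[OF *(2)] by (auto simp: lefts_def)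
    then show ?thesis using nodone[of p' "(Y, q)"] * by simp
  next
    case 3
    then obtain p' X q where "dn p' (X, q) \<in> set l" by (fastforce simp: return_rules_def)
    then show ?thesis using nodone by blast
  next
    case 4
    then consider p' X where "l = [] @ [rd p' X]" "isfirst X"
      | p' X c e where "l = [Tm e] @ [rd p' X]" "r = [Tm e, Tm c]" "tm X = Some c"
      by (auto simp: final_rules_def)
    then show ?thesis
    proof cases
      case 1
      then show ?thesis using notfirst by blast
    next
      case 2
      from split[OF 2(1)] obtain b1 b2 where b: "b = b1 @ X # b2" "p' = p"
        "x @ [Tm e] = map Tm z @ map (rd p) b1" "y = map (rd p) b2" by blast
      have "b1 = []"
      proof (rule ccontr)
        assume "b1 \<noteq> []"
        then have "last (map Tm z @ map (rd p) b1) = (rd p (last b1) :: (('c, 'q) cell, 't) sym)"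
          by (simp add: last_map)
        then show False using arg_cong[OF b(3), of last] by simp
      qed
      then have "x @ r @ y = map Tm (z @ [c]) @ map (rd p) b2" "g = (a @ [X]) @ b2"
        "map tm (a @ [X]) = map Some (z @ [c])" using ab b 2 by auto
      then have "finishing p g (x @ r @ y)" unfolding finishing_def by blast
      then show ?thesis using g by (auto simp: inv_def)
    qed
  qed
qed

lemma rules_lhs_nonempty: "(l, r) \<in> rules \<Longrightarrow> l \<noteq> []"
  by (auto simp: rules_def init_rules_def sweep_rules_def return_rules_def final_rules_def split: if_splits)

lemma derives_inv:
  assumes "(derive1 rules)\<^sup>*\<^sup>* [NT Init] s"
  shows "s = [NT Init] \<or> (s = [] \<and> erase) \<or> inv s"
  using assms
proof (induction rule: rtranclp_induct)
  case (step s t)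
  from step.hyps(2) obtain x y l r where lr: "(l, r) \<in> rules" and s: "s = x @ l @ y" and t: "t = x @ r @ y"
    by (auto simp: derive1_def)
  from step.IH show ?case
  proof (elim disjE conjE)
    assume "s = [NT Init]"
    then have "l = [NT Init]" "x = []" "y = []"
      using s rules_lhs_nonempty[OF lr] by (cases x; cases l; auto)+
    then have "(l, r) \<in> init_rules" using lr
      by (auto simp: rules_def sweep_rules_def return_rules_def final_rules_def Cons_eq_append_conv)
    then have "(r = [] \<and> erase) \<or> r = map (rd True) [c0]"
      by (auto simp: init_rules_def split: if_splits)
    then show ?thesis
    proof
      assume "r = map (rd True) [c0]"
      then have "forward True [c0] t" using forward_start[of "[c0]" True] t \<open>x = []\<close> \<open>y = []\<close> by simp
      then show ?thesis by (auto simp: inv_def)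
    qed (use t \<open>x = []\<close> \<open>y = []\<close> in simp)
  next
    assume "s = []"
    then show ?thesis using s rules_lhs_nonempty[OF lr] by simp
  next
    assume "inv s"
    then show ?thesis
      using s t forward_step[OF _ _ lr] backward_step[OF _ _ lr] finishing_step[OF _ _ lr]
      unfolding inv_def by blast
  qed
qed simp

section \<open>Completeness: carrying out a run\<close>

lemma foldl_delta_closed: "set v \<subseteq> C \<Longrightarrow> foldl delta q0 v \<in> Q"
  by (induction v rule: rev_induct) (auto simp: q0 delta_closed)

lemma sweep_ruleI:
  assumes "X \<in> C" "q \<in> Q" "w \<in> ex X" "u \<in> lefts p X q" "islast X \<Longrightarrow> acc (delta q X)"
  shows "(u @ [rd p X], u @ out p X q w) \<in> rules"
  unfolding rules_def sweep_rules_def using assms by blast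

lemma left_context:
  assumes "isfirst X \<longleftrightarrow> D = []" "set (map fst D) \<subseteq> C" "D = [] \<Longrightarrow> q = q0" "D \<noteq> [] \<Longrightarrow> snd (last D) = q"
  obtains x u where "map (dn p) D = x @ u" "u \<in> lefts p X q"
proof (cases "D = []")
  case True
  then show ?thesis using that[of "[]" "[]"] assms by (simp add: lefts_def)
next
  case False
  then obtain D' Y where "D = D' @ [(Y, q)]" using assms(4) by (metis append_butlast_last_id prod.collapse)
  then show ?thesis using that[of "map (dn p) D'" "[dn p (Y, q)]"] False assms(1,2) by (simp add: lefts_def)
qed

text \<open>\<open>b\<close> stays nonempty because the last letter obeys a different rule, with the
  acceptance test; \<open>derives_reach\<close> deals with it.\<close>

lemma derives_sweep:
  assumes "lstep ex a a'" "b \<noteq> []" "reach (a @ b)"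
  shows "\<exists>D. map fst D = a' \<and> snd ` set D \<subseteq> Q \<and> (D \<noteq> [] \<longrightarrow> snd (last D) = foldl delta q0 a) \<and>
    (derive1 rules)\<^sup>*\<^sup>* (map (rd p) (a @ b)) (map (dn p) D @ map (rd p) b)"
  using assms
proof (induction a arbitrary: a' b rule: rev_induct)
  case Nil
  then show ?case by (auto elim: lstep_NilE)
next
  case (snoc X a)
  from snoc.prems(1) obtain a1 w where a': "a' = a1 @ w" "lstep ex a a1" "w \<in> ex X"
    by (auto elim!: lstep_appendE simp: lstep_single)
  have "reach (a @ X # b)" using snoc.prems(3) by simp
  from snoc.IH[OF a'(2) _ this] obtain D where D: "map fst D = a1" "snd ` set D \<subseteq> Q"
    "D \<noteq> [] \<Longrightarrow> snd (last D) = foldl delta q0 a"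
    "(derive1 rules)\<^sup>*\<^sup>* (map (rd p) (a @ X # b)) (map (dn p) D @ map (rd p) (X # b))" by auto
  have fl: "(isfirst X \<longleftrightarrow> a = []) \<and> (islast X \<longleftrightarrow> b = [])"
    using reach_flags[of "a @ X # b" a X b] snoc.prems(3) by simp
  have C: "set (a @ X # b) \<subseteq> C" using reach_closed[of "a @ X # b"] snoc.prems(3) by simp
  \<comment> \<open>As expansions are nonempty, \<open>D\<close> is empty only at the left end of
    the level, exactly where \<open>X\<close> is flagged first.\<close>
  have Da: "D = [] \<longleftrightarrow> a = []" using a'(2) D(1) lstep_empty by (auto elim: lstep_NilE)
  let ?q = "foldl delta q0 a"
  have "set a1 \<subseteq> C" using lstep_closed[OF a'(2)] C by simp
  then have left: "isfirst X \<longleftrightarrow> D = []" "set (map fst D) \<subseteq> C" "D = [] \<Longrightarrow> ?q = q0" "D \<noteq> [] \<Longrightarrow> snd (last D) = ?q"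
    using fl Da D(1,3) by auto
  obtain x u where xu: "map (dn p) D = x @ u" "u \<in> lefts p X ?q"
    by (rule left_context[OF left])
  have "(u @ [rd p X], u @ out p X ?q w) \<in> rules"
    using C fl snoc.prems(2) foldl_delta_closed by (intro sweep_ruleI xu(2) a'(3)) auto
  then have "derive1 rules (x @ (u @ [rd p X]) @ map (rd p) b) (x @ (u @ out p X ?q w) @ map (rd p) b)"
    by (intro derive1_context derive1_rule)
  then have "derive1 rules (map (dn p) D @ map (rd p) (X # b)) (map (dn p) D @ out p X ?q w @ map (rd p) b)"
    using xu(1) by simp
  with D(4) have d: "(derive1 rules)\<^sup>*\<^sup>* (map (rd p) (a @ X # b)) (map (dn p) D @ out p X ?q w @ map (rd p) b)"
    by (rule rtranclp.rtrancl_into_rtrancl)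
  let ?D = "D @ map (\<lambda>Y. (Y, delta ?q X)) w"
  have "out p X ?q w = map (dn p) (map (\<lambda>Y. (Y, delta ?q X)) w)"
    using fl snoc.prems(2) by (simp add: out_def)
  then have "(derive1 rules)\<^sup>*\<^sup>* (map (rd p) ((a @ [X]) @ b)) (map (dn p) ?D @ map (rd p) b)"
    using d by simp
  moreover have "snd ` set ?D \<subseteq> Q" using D(2) foldl_delta_closed[of a] C delta_closed by auto
  moreover have "snd (last ?D) = foldl delta q0 (a @ [X])"
    using ex_nonempty[OF a'(3)] by (simp add: last_map)
  ultimately show ?case using D(1) a'(1) by (intro exI[of _ ?D]) (auto simp: comp_def)
qed

lemma derives_return:
  assumes "b \<noteq> []" "set (map fst D @ b) \<subseteq> C" "snd ` set D \<subseteq> Q"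
  shows "(derive1 rules)\<^sup>*\<^sup>* (map (dn p) D @ map (rd (\<not> p)) b) (map (rd (\<not> p)) (map fst D @ b))"
  using assms
proof (induction D arbitrary: b rule: rev_induct)
  case (snoc d D)
  obtain X q where d: "d = (X, q)" by fastforce
  obtain Y c where b: "b = Y # c" using snoc.prems(1) by (cases b) auto
  have "([dn p (X, q), rd (\<not> p) Y], [rd (\<not> p) X, rd (\<not> p) Y]) \<in> rules"
    unfolding rules_def return_rules_def using snoc.prems d b by auto
  then have "derive1 rules (map (dn p) D @ [dn p (X, q), rd (\<not> p) Y] @ map (rd (\<not> p)) c)
     (map (dn p) D @ [rd (\<not> p) X, rd (\<not> p) Y] @ map (rd (\<not> p)) c)"
    by (intro derive1_context derive1_rule)
  then have "derive1 rules (map (dn p) (D @ [d]) @ map (rd (\<not> p)) b) (map (dn p) D @ map (rd (\<not> p)) (X # b))"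
    using d b by simp
  moreover have "(derive1 rules)\<^sup>*\<^sup>* (map (dn p) D @ map (rd (\<not> p)) (X # b)) (map (rd (\<not> p)) (map fst D @ X # b))"
    using snoc d by (intro snoc.IH) auto
  ultimately show ?case using d by (simp add: converse_rtranclp_into_rtranclp)
qed simp

text \<open>The parity is existential because it alternates from level to level.\<close>

lemma derives_reach:
  assumes "reach g"
  shows "\<exists>p. (derive1 rules)\<^sup>*\<^sup>* [NT Init] (map (rd p) g)"
  using assms
proof (induction rule: rtranclp_induct)
  case base
  have "derive1 rules [NT Init] [rd True c0]"
    by (rule derive1_rule) (simp add: rules_def init_rules_def)
  then show ?case by (intro exI[of _ True]) auto
next
  case (step g h)
  from step.IH obtain p where p: "(derive1 rules)\<^sup>*\<^sup>* [NT Init] (map (rd p) g)" by blast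
  from step.hyps(2) have acc: "acc (foldl delta q0 g)" and st: "lstep ex g h" by (auto simp: ustep_def)
  have gC: "g \<noteq> []" "set g \<subseteq> C" using reach_closed[OF step.hyps(1)] by auto
  have hC: "set h \<subseteq> C" using lstep_closed[OF st gC(2)] .
  obtain a X where g: "g = a @ [X]" using gC(1) by (metis rev_exhaust)
  from st obtain a' w where h: "h = a' @ w" "lstep ex a a'" "w \<in> ex X"
    unfolding g by (auto elim!: lstep_appendE simp: lstep_single)
  from derives_sweep[OF h(2), of "[X]" p] step.hyps(1) g obtain D where D: "map fst D = a'" "snd ` set D \<subseteq> Q"
    "D \<noteq> [] \<Longrightarrow> snd (last D) = foldl delta q0 a"
    "(derive1 rules)\<^sup>*\<^sup>* (map (rd p) g) (map (dn p) D @ [rd p X])" by auto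
  have fl: "(isfirst X \<longleftrightarrow> a = []) \<and> islast X" using reach_flags[OF step.hyps(1), of a X "[]"] g by simp
  have Da: "D = [] \<longleftrightarrow> a = []" using h(2) D(1) lstep_empty by (auto elim: lstep_NilE)
  let ?q = "foldl delta q0 a"
  have left: "isfirst X \<longleftrightarrow> D = []" "set (map fst D) \<subseteq> C" "D = [] \<Longrightarrow> ?q = q0" "D \<noteq> [] \<Longrightarrow> snd (last D) = ?q"
    using fl Da D(1,3) hC h(1) by auto
  obtain x u where xu: "map (dn p) D = x @ u" "u \<in> lefts p X ?q"
    by (rule left_context[OF left])
  have "(u @ [rd p X], u @ out p X ?q w) \<in> rules"
    using gC g acc foldl_delta_closed by (intro sweep_ruleI xu(2) h(3)) auto
  then have "derive1 rules (x @ (u @ [rd p X]) @ []) (x @ (u @ out p X ?q w) @ [])"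
    by (intro derive1_context derive1_rule)
  then have "derive1 rules (map (dn p) D @ [rd p X]) (map (dn p) D @ map (rd (\<not> p)) w)"
    using xu(1) fl by (simp add: out_def)
  moreover have "(derive1 rules)\<^sup>*\<^sup>* (map (dn p) D @ map (rd (\<not> p)) w) (map (rd (\<not> p)) h)"
    using derives_return[of w D p] ex_nonempty[OF h(3)] D(1,2) h(1) hC by simp
  ultimately have "(derive1 rules)\<^sup>*\<^sup>* [NT Init] (map (rd (\<not> p)) h)"
    using p D(4) by (meson rtranclp.rtrancl_into_rtrancl rtranclp_trans)
  then show ?case by blast
qed

lemma derives_finish:
  assumes "reach (a @ b)" "a \<noteq> []" "map tm a = map Some z"
  shows "(derive1 rules)\<^sup>*\<^sup>* (map (rd p) (a @ b)) (map Tm z @ map (rd p) b)"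
  using assms
proof (induction a arbitrary: b z rule: rev_induct)
  case (snoc X a)
  obtain v c where z: "z = v @ [c]" "map tm a = map Some v" "tm X = Some c"
    using snoc.prems(3) by (cases z rule: rev_cases) auto
  have r: "reach (a @ X # b)" using snoc.prems(1) by simp
  have C: "set (a @ X # b) \<subseteq> C" using reach_closed[OF r] by simp
  have fl: "isfirst X \<longleftrightarrow> a = []" using reach_flags[OF r refl] by simp
  show ?case
  proof (cases "a = []")
    case True
    then have "([rd p X], [Tm c]) \<in> rules" using C z(3) fl by (auto simp: rules_def final_rules_def)
    then have "derive1 rules ([] @ [rd p X] @ map (rd p) b) ([] @ [Tm c] @ map (rd p) b)"
      by (intro derive1_context derive1_rule)
    then show ?thesis using True z by auto
  next
    case False
    from snoc.IH[OF r False z(2)] have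
      1: "(derive1 rules)\<^sup>*\<^sup>* (map (rd p) (a @ X # b)) (map Tm v @ map (rd p) (X # b))" .
    obtain a1 Y where a: "a = a1 @ [Y]" using False by (metis rev_exhaust)
    then obtain v1 e where v: "v = v1 @ [e]" "tm Y = Some e"
      using z(2) by (cases v rule: rev_cases) auto
    have "Y \<in> C" "X \<in> C" using C a by auto
    then have "([Tm e, rd p X], [Tm e, Tm c]) \<in> rules"
      using z(3) v fl False by (fastforce simp: rules_def final_rules_def)
    then have "derive1 rules (map Tm v1 @ [Tm e, rd p X] @ map (rd p) b) (map Tm v1 @ [Tm e, Tm c] @ map (rd p) b)"
      by (intro derive1_context derive1_rule)
    then have "derive1 rules (map Tm v @ map (rd p) (X # b)) (map Tm z @ map (rd p) b)"
      using v z by simp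
    with 1 show ?thesis by (simp add: rtranclp.rtrancl_into_rtrancl)
  qed
qed simp

lemma phrase_lang_rules:
  "phrase_lang rules Init = {z. \<exists>g. reach g \<and> map tm g = map Some z} \<union> (if erase then {[]} else {})"
proof (intro equalityI subsetI)
  fix z assume "z \<in> phrase_lang rules Init"
  then have "(derive1 rules)\<^sup>*\<^sup>* [NT Init] (map Tm z)" by (simp add: phrase_lang_def)
  from derives_inv[OF this] have "(z = [] \<and> erase) \<or> inv (map Tm z)" by auto
  then show "z \<in> {z. \<exists>g. reach g \<and> map tm g = map Some z} \<union> (if erase then {[]} else {})"
  proof
    assume "inv (map Tm z)"
    then obtain p g where g: "reach g" and
      *: "forward p g (map Tm z) \<or> backward p g (map Tm z) \<or> finishing p g (map Tm z)"
      by (auto simp: inv_def)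
    \<comment> \<open>A terminal word has no ready cell, while forward and backward forms have at
      least one; only a completed finishing form remains.\<close>
    have nb: "b = []" if "map Tm z = s @ (map (rd p) b :: (('c, 'q) cell, 't) sym list)" for s b p
      using that by (cases b) (auto simp: map_eq_append_conv)
    then have "\<not> forward p g (map Tm z)" "\<not> backward p g (map Tm z)"
      by (auto simp: forward_def backward_def)
    with * have "finishing p g (map Tm z)" by blast
    then obtain a b v where f: "g = a @ b" "map Tm z = map Tm v @ (map (rd p) b :: (('c, 'q) cell, 't) sym list)" "map tm a = map Some v"
      by (auto simp: finishing_def)
    then have "b = []" using nb by blast
    then have "z = v" using f(2) by (auto simp: inj_map_eq_map inj_def)
    then show ?thesis using f g \<open>b = []\<close> by auto
  qed auto
next
  fix z assume "z \<in> {z. \<exists>g. reach g \<and> map tm g = map Some z} \<union> (if erase then {[]} else {})"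
  then consider g where "reach g" "map tm g = map Some z" | "z = []" erase by (auto split: if_splits)
  then show "z \<in> phrase_lang rules Init"
  proof cases
    case 1
    then obtain p where "(derive1 rules)\<^sup>*\<^sup>* [NT Init] (map (rd p) g)" using derives_reach by blast
    moreover have "(derive1 rules)\<^sup>*\<^sup>* (map (rd p) g) (map Tm z)"
      using derives_finish[of g "[]" z p] 1 reach_closed[OF 1(1)] by simp
    ultimately show ?thesis by (simp add: phrase_lang_def)
  next
    case 2
    then have "([NT Init], []) \<in> rules" unfolding rules_def init_rules_def using 2(2) by simp
    then show ?thesis using 2(1) derive1_rule by (force simp: phrase_lang_def)
  qed
qed

lemma language_in_CS: "{z. \<exists>g. reach g \<and> map tm g = map Some z} \<union> (if erase then {[]} else {}) \<in> CS"
proof -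
  have noInit: "NT Init \<notin> set r" if "(l, r) \<in> rules" for l r
    using that by (auto simp: rules_def init_rules_def sweep_rules_def return_rules_def final_rules_def
        lefts_def out_def split: if_splits)
  have "(\<exists>u A v w. w \<noteq> [] \<and> l = u @ [NT A] @ v \<and> r = u @ w @ v) \<or>
      (l = [NT Init] \<and> r = [] \<and> (\<forall>(l', r') \<in> rules. NT Init \<notin> set r'))" if lr: "(l, r) \<in> rules" for l r
  proof -
    consider "(l, r) \<in> init_rules" | "(l, r) \<in> sweep_rules" | "(l, r) \<in> return_rules" | "(l, r) \<in> final_rules"
      using lr by (auto simp: rules_def)
    then show ?thesis
    proof cases
      case 1
      then consider "l = [] @ [NT Init] @ []" "r = [] @ [rd True c0] @ []" | "l = [NT Init]" "r = []"
        by (auto simp: init_rules_def split: if_splits)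
      then show ?thesis
      proof cases
        case 1
        then show ?thesis by blast
      next
        case 2
        then show ?thesis using noInit by blast
      qed
    next
      case 2
      then obtain p X q w u where "w \<in> ex X" "l = u @ [rd p X] @ []" "r = u @ out p X q w @ []"
        by (auto simp: sweep_rules_def)
      moreover have "out p X q w \<noteq> []" using ex_nonempty[OF calculation(1)] by (simp add: out_def)
      ultimately show ?thesis by blast
    next
      case 3
      then obtain p X q Y where "l = [] @ [NT (Done p X q)] @ [rd (\<not> p) Y]" "r = [] @ [rd (\<not> p) X] @ [rd (\<not> p) Y]"
        by (auto simp: return_rules_def)
      then show ?thesis by blast
    next
      case 4
      then obtain u p X a where "l = u @ [rd p X] @ []" "r = u @ [Tm a] @ []"
        by (auto simp: final_rules_def)
      then show ?thesis by blast
    qed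
  qed
  from CS_I[OF finite_rules this] show ?thesis unfolding phrase_lang_rules by blast
qed

end

section \<open>Tree-controlled languages are context-sensitive\<close>

text \<open>The first and last letters of a level are flagged, since context-sensitive rules cannot detect the
  ends of a sentential form.\<close>

fun flag_ends :: "bool \<Rightarrow> bool \<Rightarrow> 'a list \<Rightarrow> ('a \<times> bool \<times> bool) list" where
  "flag_ends f l [] = []"
| "flag_ends f l (X # g) = (X, f, l \<and> g = []) # flag_ends False l g"

text \<open>A flag passes to the outermost child on its side, so flags are maintained without a look
  at the neighbours.\<close>

definition flagged :: "('a \<Rightarrow> 'a list set) \<Rightarrow> 'a \<times> bool \<times> bool \<Rightarrow> ('a \<times> bool \<times> bool) list set" where
  "flagged ex = (\<lambda>(X, f, l). flag_ends f l ` ex X)"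

lemma flag_ends_append:
  "flag_ends f l (g @ h) = flag_ends f (l \<and> h = []) g @ flag_ends (f \<and> g = []) l h"
  by (induction g arbitrary: f) auto

lemma map_fst_flag_ends [simp]: "map fst (flag_ends f l g) = g"
  by (induction g arbitrary: f) auto

lemma flag_ends_Nil_iff [simp]: "flag_ends f l g = [] \<longleftrightarrow> g = []"
  by (cases g) auto

lemma flag_ends_flags:
  "flag_ends f l g = u @ X # v \<Longrightarrow> (fst (snd X) \<longleftrightarrow> f \<and> u = []) \<and> (snd (snd X) \<longleftrightarrow> l \<and> v = [])"
proof (induction g arbitrary: f u)
  case (Cons Y g)
  show ?case
  proof (cases u)
    case Nil
    then show ?thesis using Cons.prems by auto
  next
    case (Cons z u')
    then show ?thesis using Cons.prems Cons.IH[of False u'] by auto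
  qed
qed simp

lemma lstep_Nil_iff:
  assumes "\<And>X. [] \<notin> ex X" "lstep ex g h"
  shows "g = [] \<longleftrightarrow> h = []"
  using assms(2) by cases (use assms(1) in auto)

text \<open>An empty expansion of an end letter would lose the flag, which
  \<open>[] \<notin> ex X\<close> prevents.\<close>

lemma lstep_flag_ends:
  assumes "\<And>X. [] \<notin> ex X"
  shows "lstep ex g h \<Longrightarrow> lstep (flagged ex) (flag_ends f l g) (flag_ends f l h)"
proof (induction arbitrary: f rule: lstep.induct)
  case (lstep_Cons w X g h)
  have "w \<noteq> []" using assms lstep_Cons.hyps(1) by metis
  then have "flag_ends f l (w @ h) = flag_ends f (l \<and> g = []) w @ flag_ends False l h"
    using lstep_Nil_iff[OF assms lstep_Cons.hyps(2)] by (simp add: flag_ends_append)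
  then show ?case using lstep_Cons by (auto simp: flagged_def intro!: lstep.lstep_Cons)
qed (simp add: lstep_Nil)

lemma lstep_flagged:
  assumes "\<And>X. [] \<notin> ex X"
  shows "lstep (flagged ex) (flag_ends f l g) h \<Longrightarrow> \<exists>k. h = flag_ends f l k \<and> lstep ex g k"
proof (induction g arbitrary: f h)
  case Nil
  then have "h = []" by (auto elim: lstep_NilE)
  then show ?case by (intro exI[of _ "[]"]) (simp add: lstep_Nil)
next
  case (Cons X g)
  from Cons.prems obtain w h' where w: "h = flag_ends f (l \<and> g = []) w @ h'" "w \<in> ex X"
    "lstep (flagged ex) (flag_ends False l g) h'"
    by (auto elim!: lstep_ConsE simp: flagged_def)
  from Cons.IH[OF w(3)] obtain k where k: "h' = flag_ends False l k" "lstep ex g k" by blast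
  have "w \<noteq> []" using assms w(2) by metis
  then have "h = flag_ends f l (w @ k)"
    using w(1) k lstep_Nil_iff[OF assms k(2)] by (simp add: flag_ends_append)
  then show ?case using lstep_Cons[OF w(2) k(2)] by blast
qed

text \<open>A state is the set of continuations that would still be accepted. A \<open>Fin\<close>
  item has an empty active word and leaves the state unchanged.\<close>

definition next_residual :: "('n, 't) sym list set \<Rightarrow> ('n, 't) item \<times> bool \<times> bool \<Rightarrow> ('n, 't) sym list set" where
  "next_residual q c = residual (active [fst c]) q"

lemma residual_append: "residual v (residual u L) = residual (u @ v) L"
  by (simp add: residual_def)

lemma foldl_next_residual: "foldl next_residual q g = residual (active (map fst g)) q"
proof (induction g arbitrary: q)
  case (Cons c g)
  have "active (map fst (c # g)) = active [fst c] @ active (map fst g)"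
    unfolding active_append[symmetric] by simp
  then show ?case using Cons by (simp add: next_residual_def residual_append)
qed (simp add: residual_def)

text \<open>The rules are non-erasing here; the free parameter \<open>erase\<close> lets the caller
  add the empty word.\<close>

lemma tree_lang_in_CS:
  fixes P :: "('n \<times> ('n, 't) sym list) set"
  assumes fin: "finite P" and ne: "\<And>A w. (A, w) \<in> P \<Longrightarrow> w \<noteq> []" and R: "finite (residuals R)"
  shows "tree_lang P S R \<union> (if erase then {[]} else {}) \<in> CS"
proof -
  define X where "X = insert (NT S) (\<Union>p\<in>P. set (snd p))"
  \<comment> \<open>\<open>Fin a\<close> is included for every terminal in use, which makes
    \<open>I\<close> closed under \<open>expand P\<close>.\<close>
  define I where "I = Act ` X \<union> Fin ` (Tm -` X)"
  have finX: "finite X" using fin by (simp add: X_def)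
  have finI: "finite I" using finX finite_vimageI[OF finX, of Tm] by (auto simp: I_def inj_def)
  have XP: "x \<in> X" if "(A, w) \<in> P" "x \<in> set w" for A w x using that by (force simp: X_def)
  have enil: "[] \<notin> expand P c" for c
    using ne by (cases "(P, c)" rule: expand.cases) auto
  have efin: "finite (expand P c)" for c
  proof (cases "(P, c)" rule: expand.cases)
    case (1 P' A)
    have "{map Act w | w. (A, w) \<in> P} \<subseteq> (\<lambda>p. map Act (snd p)) ` P" by force
    then show ?thesis using 1 fin by (auto intro: finite_subset)
  qed auto
  have eclosed: "set w \<subseteq> I" if "c \<in> I" "w \<in> expand P c" for c w
    using that by (cases "(P, c)" rule: expand.cases) (auto simp: I_def intro!: imageI intro: XP)
  let ?c0 = "(Act (NT S) :: ('n, 't) item, True, True)"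
  let ?acc = "\<lambda>q. [] \<in> (q :: ('n, 't) sym list set)"
  let ?ustep = "\<lambda>g h. ?acc (foldl next_residual R g) \<and> lstep (flagged (expand P)) g h"
  \<comment> \<open>Flags are determined by the word, so steps with and without flags correspond,
    and \<open>[]\<close> lies in the final residual exactly if the active word is in
    \<open>R\<close>.\<close>
  have step_iff: "?ustep (flag_ends True True g) h \<longleftrightarrow> (\<exists>k. h = flag_ends True True k \<and> gstep P R g k)" for g h
    using lstep_flagged[OF enil] lstep_flag_ends[OF enil]
    by (auto simp: foldl_next_residual gstep_def residual_def)
  have reach1: "\<exists>k. h = flag_ends True True k \<and> (gstep P R)\<^sup>*\<^sup>* [Act (NT S)] k"
    if "?ustep\<^sup>*\<^sup>* [?c0] h" for h
    using that
  proof (induction rule: rtranclp_induct)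
    case base
    show ?case by (intro exI[of _ "[Act (NT S)]"]) auto
  next
    case (step g h)
    then obtain k where k: "g = flag_ends True True k" "(gstep P R)\<^sup>*\<^sup>* [Act (NT S)] k" by blast
    with step.hyps(2) step_iff[of k h] obtain k' where
      k': "h = flag_ends True True k'" "gstep P R k k'" by auto
    from k'(1) rtranclp.rtrancl_into_rtrancl[OF k(2) k'(2)] show ?case by blast
  qed
  have reach2: "?ustep\<^sup>*\<^sup>* [?c0] (flag_ends True True k)" if "(gstep P R)\<^sup>*\<^sup>* [Act (NT S)] k" for k
    using that
  proof (induction rule: rtranclp_induct)
    case (step g h)
    then have "?ustep (flag_ends True True g) (flag_ends True True h)" using step_iff by blast
    with step.IH show ?case by (rule rtranclp.rtrancl_into_rtrancl)
  qed simp
  interpret level_system "flagged (expand P)" ?c0 "\<lambda>c. fst (snd c)" "\<lambda>c. snd (snd c)" "\<lambda>c. trm (fst c)"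
    next_residual R ?acc "I \<times> UNIV" "residuals R" erase
  proof
    show "?c0 \<in> I \<times> UNIV" by (simp add: I_def X_def)
    show "R \<in> residuals R" by (auto simp: residuals_def residual_def intro!: image_eqI[of _ _ "[]"])
    show "next_residual q c \<in> residuals R" if "q \<in> residuals R" for q c
      using that by (auto simp: residuals_def next_residual_def residual_append)
    show "set w \<subseteq> I \<times> UNIV" if cw: "c \<in> I \<times> UNIV" "w \<in> flagged (expand P) c" for c w
    proof -
      obtain d f l where c: "c = (d, f, l)" by (cases c) auto
      then obtain v where "w = flag_ends f l v" "v \<in> expand P d" using cw by (auto simp: flagged_def)
      then have "fst ` set w \<subseteq> I"
        using eclosed[of d v] cw(1) c map_fst_flag_ends[of f l v] by (auto simp flip: set_map)
      then show ?thesis by force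
    qed
    show "(fst (snd c) \<longleftrightarrow> u = []) \<and> (snd (snd c) \<longleftrightarrow> v = [])"
      if "?ustep\<^sup>*\<^sup>* [?c0] g" "g = u @ c # v" for g u c v
      using reach1[OF that(1)] that(2) flag_ends_flags[of True True _ u c v] by auto
  qed (use finI R efin enil in \<open>auto simp: flagged_def\<close>)
  have "(\<exists>g. reach g \<and> map (\<lambda>c. trm (fst c)) g = map Some z) \<longleftrightarrow> z \<in> tree_lang P S R" for z
  proof
    assume "\<exists>g. reach g \<and> map (\<lambda>c. trm (fst c)) g = map Some z"
    then obtain g where g: "?ustep\<^sup>*\<^sup>* [?c0] g" "map trm (map fst g) = map Some z"
      unfolding ustep_def[abs_def] by (auto simp: comp_def)
    from reach1[OF g(1)] obtain k where k: "g = flag_ends True True k" "(gstep P R)\<^sup>*\<^sup>* [Act (NT S)] k"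
      by blast
    then have "map trm k = map Some z" using g(2) by (simp only: map_fst_flag_ends)
    with k(2) show "z \<in> tree_lang P S R" unfolding tree_lang_iff by blast
  next
    assume "z \<in> tree_lang P S R"
    then obtain k where k: "(gstep P R)\<^sup>*\<^sup>* [Act (NT S)] k" "map trm k = map Some z"
      unfolding tree_lang_iff by blast
    have "map (\<lambda>c. trm (fst c)) (flag_ends True True k) = map trm (map fst (flag_ends True True k))"
      by (simp only: map_map comp_def)
    then have "map (\<lambda>c. trm (fst c)) (flag_ends True True k) = map Some z" using k(2) by simp
    with reach2[OF k(1)] show "\<exists>g. reach g \<and> map (\<lambda>c. trm (fst c)) g = map Some z"
      unfolding ustep_def[abs_def] by blast
  qed
  then show ?thesis using language_in_CS by simp
qed

section \<open>Separating the erasing rule of a tree-controlled grammar\<close>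

lemma lstep_mono:
  assumes "lstep ex g h" "\<And>X w. X \<in> set g \<Longrightarrow> w \<in> ex X \<Longrightarrow> w \<in> ex' X"
  shows "lstep ex' g h"
  using assms by (induction rule: lstep.induct) (auto intro: lstep.intros)

lemma lstep_set: "lstep ex g h \<Longrightarrow> Y \<in> set h \<Longrightarrow> \<exists>X\<in>set g. \<exists>w\<in>ex X. Y \<in> set w"
  by (induction rule: lstep.induct) auto

lemma TC_UF_subset_CS: "TC_UF \<subseteq> CS"
proof
  fix L :: "'t list set" assume "L \<in> TC_UF"
  then obtain N T P S e where tcg: "tcg N T P S (uf_lang e)" and L: "L = tree_lang P S (uf_lang e)"
    by (auto simp: TC_UF_def union_free_def tc_lang_eq_tree_lang)
  let ?R = "uf_lang e"
  define Q where "Q = {p \<in> P. snd p \<noteq> []}"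
  \<comment> \<open>The tree that uses the erasing rule is a root without children. Its height is 1,
    so \<open>[NT S]\<close> is its only controlled level.\<close>
  let ?erase = "(S, []) \<in> P \<and> [NT S] \<in> ?R"
  have finP: "finite P" using tcg by (simp add: tcg_def)
  have rule: "A = S" "NT S \<notin> set v" if "(A, []) \<in> P" "(B, v) \<in> P" for A B v
    using tcg that unfolding tcg_def by fastforce+
  have QP: "gstep P ?R g h" if "gstep Q ?R g h" for g h
  proof -
    have e: "w \<in> expand P X" if "w \<in> expand Q X" for X w
      using that by (cases "(Q, X)" rule: expand.cases) (auto simp: Q_def)
    show ?thesis using that lstep_mono[OF _ e] by (auto simp: gstep_def)
  qed
  have "(gstep P ?R)\<^sup>*\<^sup>* g h" if "(gstep Q ?R)\<^sup>*\<^sup>* g h" for g h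
    using that by (induction rule: rtranclp_induct) (auto intro: QP rtranclp.rtrancl_into_rtrancl)
  then have sub: "tree_lang Q S ?R \<subseteq> tree_lang P S ?R"
    unfolding subset_iff tree_lang_iff by blast
  have "tree_lang P S ?R = tree_lang Q S ?R \<union> (if ?erase then {[]} else {})"
  proof (cases "(S, []) \<in> P")
    case False
    have "Q = P" using rule False by (force simp: Q_def)
    then show ?thesis using False by simp
  next
    case True
    have inv: "(g = [] \<and> [NT S] \<in> ?R) \<or> ((gstep Q ?R)\<^sup>*\<^sup>* [Act (NT S)] g \<and> (g = [Act (NT S)] \<or> Act (NT S) \<notin> set g))"
      if "(gstep P ?R)\<^sup>*\<^sup>* [Act (NT S)] g" for g
      using that
    proof (induction rule: rtranclp_induct)
      case (step g h)
      from step.hyps(2) have act: "active g \<in> ?R" and st: "lstep (expand P) g h" by (auto simp: gstep_def)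
      have noS: "Act (NT S) \<notin> set h"
      proof
        assume "Act (NT S) \<in> set h"
        from lstep_set[OF st this] obtain X w where "w \<in> expand P X" "Act (NT S) \<in> set w" by blast
        then obtain A v where "(A, v) \<in> P" "NT S \<in> set v" by (cases "(P, X)" rule: expand.cases) auto
        then show False using rule(2)[OF True] by blast
      qed
      from step.IH consider "g = []" "[NT S] \<in> ?R" | "g = [Act (NT S)]"
        | "(gstep Q ?R)\<^sup>*\<^sup>* [Act (NT S)] g" "Act (NT S) \<notin> set g" by blast
      then show ?case
      proof cases
        case 1
        then show ?thesis using st by (auto elim: lstep_NilE)
      next
        case 2
        then obtain w where w: "(S, w) \<in> P" "h = map Act w" using st by (auto simp: lstep_single)
        show ?thesis
        proof (cases "w = []")
          case True
          then show ?thesis using w act 2 by simp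
        next
          case False
          then have "gstep Q ?R g h" using w act 2 by (auto simp: gstep_def lstep_single Q_def)
          then show ?thesis using 2 noS by auto
        qed
      next
        case 3
        \<comment> \<open>Only \<open>S\<close> has an empty right-hand side and \<open>S\<close>
          does not occur in \<open>g\<close>, so every rule applied is in \<open>Q\<close>.\<close>
        have "w \<in> expand Q X" if "X \<in> set g" "w \<in> expand P X" for X w
          using that 3(2) rule(1)[OF _ True] by (cases "(P, X)" rule: expand.cases) (auto simp: Q_def)
        from lstep_mono[OF st this] have "gstep Q ?R g h" using act by (simp add: gstep_def)
        then show ?thesis using 3(1) noS by (auto intro: rtranclp.rtrancl_into_rtrancl)
      qed
    qed simp
    have "z \<in> tree_lang Q S ?R \<or> (z = [] \<and> [NT S] \<in> ?R)" if "z \<in> tree_lang P S ?R" for z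
      using that inv unfolding tree_lang_iff by fastforce
    moreover have "[] \<in> tree_lang P S ?R" if "[NT S] \<in> ?R"
    proof -
      have "gstep P ?R [Act (NT S)] []" using True that by (auto simp: gstep_def lstep_single)
      then show ?thesis by (auto simp: tree_lang_iff)
    qed
    ultimately show ?thesis using sub True by auto
  qed
  moreover have "tree_lang Q S ?R \<union> (if ?erase then {[]} else {}) \<in> CS"
    by (rule tree_lang_in_CS) (auto simp: Q_def finP finite_residuals_uf_lang)
  ultimately show "L \<in> CS" using L by simp
qed

theorem mainTheorem3:
  shows "(TC_UF :: 't list set set) = CS"
  using TC_UF_subset_CS CS_subset_TC_UF by (rule subset_antisym)

end
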